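(* Let $R$ be a local domain of dimension $2$ that has an $S_2$-ification $S$. Then the module closure $\mathrm{cl}_S$ is the smallest big Cohen-Macaulay module closure on $R$; that is, $\mathrm{cl}_S$ is a big Cohen-Macaulay module closure, and for every big Cohen-Macaulay $R$-module $B'$ and all finitely generated $R$-modules $N\subseteq M$, $N_M^{\mathrm{cl}_S}\subseteq N_M^{\mathrm{cl}_{B'}}$.
   Context: Local rings are commutative Noetherian. For an $R$-module $S$, the module closure $\mathrm{cl}_S$ is defined, for finitely generated $R$-modules $N\subseteq M$ and $u\in M$, by: $u\in N_M^{\mathrm{cl}_S}$ iff for all $s\in S$, $s\otimes u\in \operatorname{im}(S\otimes_R N\to S\otimes_R M)$. A (balanced) big Cohen-Macaulay module for a local ring $(R,m)$ is an $R$-module $B$, not necessarily finitely generated, such that every system of parameters for $R$ is a regular sequence on $B$ and $mB\ne B$. A big Cohen-Macaulay module closure is a module closure $\mathrm{cl}_B$ with $B$ a big Cohen-Macaulay module. For a local domain $R$, the $S_2$-ification of $R$ is the unique smallest extension of $R$ in its fraction field that satisfies Serre's condition $S_2$, if such a ring exists. When it exists, it can be constructed by adding to $R$ all elements $f\in\operatorname{Frac}(R)$ such that some height $2$ ideal of $R$ multiplies $f$ into $R$. *)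

theory Defs
  imports "HOL-Algebra.Algebra" "HOL-Library.Extended_Nat"
begin

section \<open>Local rings, dimension, parameters\<close>

definition local_ring :: "('a, 'r) ring_scheme \<Rightarrow> bool" where
  "local_ring R \<longleftrightarrow> cring R \<and> noetherian_ring R \<and> (\<exists>!m. maximalideal m R)"

definition max_ideal :: "('a, 'r) ring_scheme \<Rightarrow> 'a set" where
  "max_ideal R = (THE m. maximalideal m R)"

text \<open>A chain \<open>P\<^sub>0 \<subset> \<dots> \<subset> P\<^sub>n\<close> of primes is a list with \<open>n + 1\<close> entries.\<close>

definition prime_chain :: "('a, 'r) ring_scheme \<Rightarrow> 'a set list \<Rightarrow> bool" where
  "prime_chain R Ps \<longleftrightarrow>
     Ps \<noteq> [] \<and> (\<forall>P\<in>set Ps. primeideal P R) \<and> sorted_wrt (\<subset>) Ps"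

definition krull_dim :: "('a, 'r) ring_scheme \<Rightarrow> enat" where
  "krull_dim R = Sup {enat (length Ps - 1) | Ps. prime_chain R Ps}"

definition height :: "('a, 'r) ring_scheme \<Rightarrow> 'a set \<Rightarrow> enat" where
  "height R P = Sup {enat (length Ps - 1) | Ps. prime_chain R Ps \<and> last Ps = P}"

definition radical :: "('a, 'r) ring_scheme \<Rightarrow> 'a set \<Rightarrow> 'a set" where
  "radical R I = {r \<in> carrier R. \<exists>n::nat. r [^]\<^bsub>R\<^esub> n \<in> I}"

definition system_of_parameters :: "('a, 'r) ring_scheme \<Rightarrow> 'a list \<Rightarrow> bool" where
  "system_of_parameters R xs \<longleftrightarrow>
     enat (length xs) = krull_dim R \<and> set xs \<subseteq> max_ideal R \<and>
     radical R (genideal R (set xs)) = max_ideal R"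


section \<open>Generated submodules, regular sequences, depth\<close>

definition generated_submodule ::
    "('a, 'r) ring_scheme \<Rightarrow> ('a, 'b, 'm) module_scheme \<Rightarrow> 'b set \<Rightarrow> 'b set" where
  "generated_submodule R M A = \<Inter>{N. submodule N R M \<and> A \<subseteq> N}"

definition finitely_generated_module ::
    "('a, 'r) ring_scheme \<Rightarrow> ('a, 'b, 'm) module_scheme \<Rightarrow> bool" where
  "finitely_generated_module R M \<longleftrightarrow>
     module R M \<and>
     (\<exists>A \<subseteq> carrier M. finite A \<and> generated_submodule R M A = carrier M)"

text \<open>\<open>I M\<close> for the ideal \<open>I\<close> generated by a set \<open>A\<close> of scalars.\<close>

definition set_smult ::
    "('a, 'r) ring_scheme \<Rightarrow> 'a set \<Rightarrow> ('a, 'b, 'm) module_scheme \<Rightarrow> 'b set" where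
  "set_smult R A M =
     generated_submodule R M {a \<odot>\<^bsub>M\<^esub> v | a v. a \<in> A \<and> v \<in> carrier M}"

text \<open>The middle conjunct says that the \<open>i\<close>-th entry is a nonzerodivisor on the quotient of
  \<open>M\<close> by the multiples of the preceding entries.\<close>

definition regular_sequence ::
    "('a, 'r) ring_scheme \<Rightarrow> ('a, 'b, 'm) module_scheme \<Rightarrow> 'a list \<Rightarrow> bool" where
  "regular_sequence R M xs \<longleftrightarrow>
     set xs \<subseteq> carrier R \<and>
     (\<forall>i < length xs. \<forall>v \<in> carrier M.
        (xs ! i) \<odot>\<^bsub>M\<^esub> v \<in> set_smult R (set (take i xs)) M \<longrightarrow>
        v \<in> set_smult R (set (take i xs)) M) \<and>
     set_smult R (set xs) M \<noteq> carrier M"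

text \<open>Only used for nonzero \<open>M\<close> (the empty sequence is not regular on the zero module, so this
  gives depth 0 there rather than the customary infinity).\<close>

definition depth ::
    "('a, 'r) ring_scheme \<Rightarrow> 'a set \<Rightarrow> ('a, 'b, 'm) module_scheme \<Rightarrow> enat" where
  "depth R I M = Sup {enat (length xs) | xs. set xs \<subseteq> I \<and> regular_sequence R M xs}"

definition big_cohen_macaulay ::
    "('a, 'r) ring_scheme \<Rightarrow> ('a, 'b, 'm) module_scheme \<Rightarrow> bool" where
  "big_cohen_macaulay R B \<longleftrightarrow>
     module R B \<and>
     (\<forall>xs. system_of_parameters R xs \<longrightarrow> regular_sequence R B xs) \<and>
     set_smult R (max_ideal R) B \<noteq> carrier B"


section \<open>Tensor products and module closures\<close>

text \<open>The tensor product is the free abelian group on pairs modulo the bilinearity and balancing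
  relations. Only its underlying additive group matters for module closures, so the (induced)
  scalar multiplication is left out.\<close>

definition tensor_relators ::
    "('a, 'r) ring_scheme \<Rightarrow> ('a, 'b, 'm) module_scheme \<Rightarrow> ('a, 'c, 'n) module_scheme
      \<Rightarrow> (('b \<times> 'c) \<Rightarrow>\<^sub>0 int) set" where
  "tensor_relators R A M =
     {frag_of (a \<oplus>\<^bsub>A\<^esub> a', u) - frag_of (a, u) - frag_of (a', u) | a a' u.
        a \<in> carrier A \<and> a' \<in> carrier A \<and> u \<in> carrier M} \<union>
     {frag_of (a, u \<oplus>\<^bsub>M\<^esub> u') - frag_of (a, u) - frag_of (a, u') | a u u'.
        a \<in> carrier A \<and> u \<in> carrier M \<and> u' \<in> carrier M} \<union>
     {frag_of (r \<odot>\<^bsub>A\<^esub> a, u) - frag_of (a, r \<odot>\<^bsub>M\<^esub> u) | r a u.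
        r \<in> carrier R \<and> a \<in> carrier A \<and> u \<in> carrier M}"

definition tensor_subgroup ::
    "('a, 'r) ring_scheme \<Rightarrow> ('a, 'b, 'm) module_scheme \<Rightarrow> ('a, 'c, 'n) module_scheme
      \<Rightarrow> (('b \<times> 'c) \<Rightarrow>\<^sub>0 int) set" where
  "tensor_subgroup R A M =
     generate (free_Abelian_group (carrier A \<times> carrier M)) (tensor_relators R A M)"

definition tensor_product ::
    "('a, 'r) ring_scheme \<Rightarrow> ('a, 'b, 'm) module_scheme \<Rightarrow> ('a, 'c, 'n) module_scheme
      \<Rightarrow> (('b \<times> 'c) \<Rightarrow>\<^sub>0 int) set monoid" where
  "tensor_product R A M =
     free_Abelian_group (carrier A \<times> carrier M) Mod tensor_subgroup R A M"

definition tensor_class ::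
    "('a, 'r) ring_scheme \<Rightarrow> ('a, 'b, 'm) module_scheme \<Rightarrow> ('a, 'c, 'n) module_scheme
      \<Rightarrow> (('b \<times> 'c) \<Rightarrow>\<^sub>0 int) \<Rightarrow> (('b \<times> 'c) \<Rightarrow>\<^sub>0 int) set" where
  "tensor_class R A M z =
     tensor_subgroup R A M #>\<^bsub>free_Abelian_group (carrier A \<times> carrier M)\<^esub> z"

definition pure_tensor ::
    "('a, 'r) ring_scheme \<Rightarrow> ('a, 'b, 'm) module_scheme \<Rightarrow> ('a, 'c, 'n) module_scheme
      \<Rightarrow> 'b \<Rightarrow> 'c \<Rightarrow> (('b \<times> 'c) \<Rightarrow>\<^sub>0 int) set" where
  "pure_tensor R A M a u = tensor_class R A M (frag_of (a, u))"

text \<open>The map \<open>id\<^sub>A \<otimes> g\<close> on \<open>A \<otimes> N\<close> with values in \<open>A \<otimes> M\<close>, for an \<open>R\<close>-linear map \<open>g\<close> from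
  \<open>N\<close> to \<open>M\<close>; \<open>the_elem\<close> picks the common class of the images of the representatives.\<close>

definition tensor_map ::
    "('a, 'r) ring_scheme \<Rightarrow> ('a, 'b, 'm) module_scheme \<Rightarrow> ('a, 'c, 'n) module_scheme
      \<Rightarrow> ('d \<Rightarrow> 'c) \<Rightarrow> (('b \<times> 'd) \<Rightarrow>\<^sub>0 int) set \<Rightarrow> (('b \<times> 'c) \<Rightarrow>\<^sub>0 int) set" where
  "tensor_map R A M g c =
     the_elem ((\<lambda>z. tensor_class R A M (frag_extend (\<lambda>(a, v). frag_of (a, g v)) z)) ` c)"

definition module_closure ::
    "('a, 'r) ring_scheme \<Rightarrow> ('a, 'b, 'm) module_scheme \<Rightarrow> ('a, 'c, 'n) module_scheme
      \<Rightarrow> 'c set \<Rightarrow> 'c set" where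
  "module_closure R B M N =
     {u \<in> carrier M. \<forall>s \<in> carrier B.
        pure_tensor R B M s u
          \<in> tensor_map R B M (\<lambda>v. v) ` carrier (tensor_product R B (M\<lparr>carrier := N\<rparr>))}"


section \<open>Fraction fields and the \<open>S\<^sub>2\<close>-ification\<close>

definition fraction_field ::
    "('a, 'r) ring_scheme \<Rightarrow> ('k, 's) ring_scheme \<Rightarrow> ('a \<Rightarrow> 'k) \<Rightarrow> bool" where
  "fraction_field R K \<phi> \<longleftrightarrow>
     domain R \<and> field K \<and> \<phi> \<in> ring_hom R K \<and> inj_on \<phi> (carrier R) \<and>
     (\<forall>z \<in> carrier K. \<exists>a \<in> carrier R. \<exists>b \<in> carrier R - {\<zero>\<^bsub>R\<^esub>}.
        z = \<phi> a \<otimes>\<^bsub>K\<^esub> inv\<^bsub>K\<^esub> (\<phi> b))"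

text \<open>A subset \<open>T\<close> of \<open>K\<close> with scalars acting through \<open>\<phi>\<close>. The ring multiplication fields of the
  record play no role for modules.\<close>

definition module_in ::
    "('k, 's) ring_scheme \<Rightarrow> ('a \<Rightarrow> 'k) \<Rightarrow> 'k set \<Rightarrow> ('a, 'k) module" where
  "module_in K \<phi> T =
     \<lparr>carrier = T, monoid.mult = (\<otimes>\<^bsub>K\<^esub>), one = \<one>\<^bsub>K\<^esub>, ring.zero = \<zero>\<^bsub>K\<^esub>, ring.add = (\<oplus>\<^bsub>K\<^esub>),
      smult = (\<lambda>r t. \<phi> r \<otimes>\<^bsub>K\<^esub> t)\<rparr>"

text \<open>Localization at a prime \<open>P\<close> of an \<open>R\<close>-submodule of \<open>K\<close>, again taken inside \<open>K\<close>.\<close>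

definition localize_in ::
    "('a, 'r) ring_scheme \<Rightarrow> ('k, 's) ring_scheme \<Rightarrow> ('a \<Rightarrow> 'k) \<Rightarrow> 'a set \<Rightarrow> 'k set \<Rightarrow> 'k set" where
  "localize_in R K \<phi> P T =
     {t \<otimes>\<^bsub>K\<^esub> inv\<^bsub>K\<^esub> (\<phi> s) | t s. t \<in> T \<and> s \<in> carrier R - P}"

text \<open>Serre's condition \<open>S\<^sub>k\<close> for a nonzero \<open>R\<close>-submodule \<open>T\<close> of \<open>K\<close>: for every prime \<open>P\<close> of
  \<open>R\<close>, the \<open>R\<^sub>P\<close>-module \<open>T\<^sub>P\<close> has depth at least \<open>min k (dim R\<^sub>P)\<close>.\<close>

definition serre_condition ::
    "nat \<Rightarrow> ('a, 'r) ring_scheme \<Rightarrow> ('k, 's) ring_scheme \<Rightarrow> ('a \<Rightarrow> 'k) \<Rightarrow> 'k set \<Rightarrow> bool" where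
  "serre_condition k R K \<phi> T \<longleftrightarrow>
     (\<forall>P. primeideal P R \<longrightarrow>
        min (enat k) (height R P) \<le>
          depth (K\<lparr>carrier := localize_in R K \<phi> P (\<phi> ` carrier R)\<rparr>)
                (localize_in R K \<phi> P (\<phi> ` P))
                (module_in K (\<lambda>x. x) (localize_in R K \<phi> P T)))"

text \<open>Serre's condition on an extension of \<open>R\<close> is imposed as an \<open>R\<close>-module, as in Hochster and
  Huneke, Indecomposable canonical modules and connectedness. As a condition on the ring \<open>T\<close> it
  would admit, for instance, one-dimensional Noetherian domains between \<open>R\<close> and \<open>K\<close>, and there
  would in general be no smallest extension.\<close>

definition S2_extension ::
    "('a, 'r) ring_scheme \<Rightarrow> ('k, 's) ring_scheme \<Rightarrow> ('a \<Rightarrow> 'k) \<Rightarrow> 'k set \<Rightarrow> bool" where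
  "S2_extension R K \<phi> T \<longleftrightarrow>
     subring T K \<and> \<phi> ` carrier R \<subseteq> T \<and> serre_condition 2 R K \<phi> T"

definition S2_ification ::
    "('a, 'r) ring_scheme \<Rightarrow> ('k, 's) ring_scheme \<Rightarrow> ('a \<Rightarrow> 'k) \<Rightarrow> 'k set \<Rightarrow> bool" where
  "S2_ification R K \<phi> S \<longleftrightarrow>
     S2_extension R K \<phi> S \<and> (\<forall>T. S2_extension R K \<phi> T \<longrightarrow> S \<subseteq> T)"


section \<open>Basic facts\<close>

lemma module_in_module:
  assumes ff: "fraction_field R K \<phi>" and T: "subring T K" "\<phi> ` carrier R \<subseteq> T"
  shows "module R (module_in K \<phi> T)"
proof -
  interpret R: domain R using ff by (simp add: fraction_field_def)
  interpret K: field K using ff by (simp add: fraction_field_def)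
  have hom: "\<phi> \<in> ring_hom R K" using ff by (simp add: fraction_field_def)
  note [simp] = ring_hom_mult[OF hom] ring_hom_add[OF hom] ring_hom_one[OF hom]
  have sub: "T \<subseteq> carrier K" by (rule subringE(1)[OF T(1)])
  then have [simp]: "t \<in> T \<Longrightarrow> t \<in> carrier K" for t by blast
  have [simp]: "r \<in> carrier R \<Longrightarrow> \<phi> r \<in> T" for r using T(2) by blast
  note [simp] = subringE(2,3,5,6,7)[OF T(1)]
  show ?thesis
  proof (rule moduleI)
    show "abelian_group (module_in K \<phi> T)"
    proof (rule abelian_groupI)
      fix x assume "x \<in> carrier (module_in K \<phi> T)"
      then show "\<exists>y\<in>carrier (module_in K \<phi> T). y \<oplus>\<^bsub>module_in K \<phi> T\<^esub> x = \<zero>\<^bsub>module_in K \<phi> T\<^esub>"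
        by (intro bexI[of _ "\<ominus>\<^bsub>K\<^esub> x"]) (auto simp: module_in_def K.l_neg)
    qed (auto simp: module_in_def K.a_ac)
  qed (auto simp: module_in_def K.l_distr K.r_distr K.m_assoc R.cring_axioms R.is_cring)
qed

lemma frag_extend_pairs: "frag_extend (\<lambda>(a, v). frag_of (a, v)) z = z"
  using frag_expansion[of z] by (simp add: case_prod_beta')

lemma tensor_map_pure_tensor:
  assumes A: "module R A" and M: "module R M" and N: "submodule N R M"
    and a: "a \<in> carrier A" and v: "v \<in> N"
  shows "tensor_map R A M (\<lambda>v. v) (pure_tensor R A (M\<lparr>carrier := N\<rparr>) a v) = pure_tensor R A M a v"
proof -
  interpret M: module R M by fact
  interpret A: module R A by fact
  interpret N: submodule N R M by fact
  have NM: "N \<subseteq> carrier M" using M.submoduleE(1)[OF N] .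
  let ?F = "free_Abelian_group (carrier A \<times> carrier M)"
  let ?G = "free_Abelian_group (carrier A \<times> N)"
  interpret F: comm_group ?F by (rule abelian_free_Abelian_group)
  interpret G: comm_group ?G by (rule abelian_free_Abelian_group)
  let ?H = "tensor_subgroup R A M"
  let ?H' = "tensor_subgroup R A (M\<lparr>carrier := N\<rparr>)"
  have "tensor_relators R A M \<subseteq> carrier ?F"
    by (auto simp: tensor_relators_def dest!: keys_diff[THEN subsetD])
  then have H: "subgroup ?H ?F"
    unfolding tensor_subgroup_def by (rule F.generate_is_subgroup)
  have rel: "tensor_relators R A (M\<lparr>carrier := N\<rparr>) \<subseteq> carrier ?G"
    using M.submoduleE(4,5)[OF N]
    by (auto simp: tensor_relators_def dest!: keys_diff[THEN subsetD])
  have relD: "Poly_Mapping.keys h \<subseteq> carrier A \<times> N"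
    if "h \<in> tensor_relators R A (M\<lparr>carrier := N\<rparr>)" for h
    using subsetD[OF rel that] by simp
  have sub: "tensor_relators R A (M\<lparr>carrier := N\<rparr>) \<subseteq> tensor_relators R A M"
    unfolding tensor_relators_def using NM by (intro Un_mono) auto
  then have H'H: "z \<in> ?H" if "z \<in> ?H'" for z
  proof -
    have "z \<in> ?H \<and> z \<in> carrier ?G"
      using that unfolding tensor_subgroup_def[of R A "M\<lparr>carrier := N\<rparr>"] partial_object.simps
    proof (induction rule: generate.induct)
      case (incl h)
      then show ?case
        using sub relD[of h] by (auto simp: tensor_subgroup_def intro: generate.incl)
    next
      case (inv h)
      then have "h \<in> ?H" and k: "Poly_Mapping.keys h \<subseteq> carrier A \<times> N"
        using sub relD[of h] by (auto simp: tensor_subgroup_def intro: generate.incl)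
      moreover have "Poly_Mapping.keys h \<subseteq> carrier A \<times> carrier M" using k NM by blast
      ultimately show ?case using subgroup.m_inv_closed[OF H, of h] by simp
    next
      case (eng x y)
      then show ?case using subgroup.m_closed[OF H, of x y] keys_add[of x y] by auto
    qed (use subgroup.one_closed[OF H] in auto)
    then show ?thesis ..
  qed
  let ?f = "\<lambda>z. tensor_class R A M (frag_extend (\<lambda>(a, v). frag_of (a, v)) z)"
  have "?f ` pure_tensor R A (M\<lparr>carrier := N\<rparr>) a v = {pure_tensor R A M a v}"
  proof -
    have 1: "?f z = pure_tensor R A M a v" if z: "z \<in> pure_tensor R A (M\<lparr>carrier := N\<rparr>) a v" for z
    proof -
      obtain h where h: "h \<in> ?H'" "z = h + frag_of (a, v)"
        using z by (auto simp: pure_tensor_def tensor_class_def r_coset_def)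
      have "z \<in> ?H #>\<^bsub>?F\<^esub> frag_of (a, v)"
        using H'H[OF h(1)] unfolding h(2) r_coset_def by auto
      moreover have "frag_of (a, v) \<in> carrier ?F" using a v NM by auto
      ultimately show ?thesis
        unfolding frag_extend_pairs pure_tensor_def tensor_class_def
        by (rule F.repr_independence[OF _ _ H, symmetric])
    qed
    have "frag_of (a, v) \<in> pure_tensor R A (M\<lparr>carrier := N\<rparr>) a v"
      using generate.one[of ?G "tensor_relators R A (M\<lparr>carrier := N\<rparr>)"]
      by (auto simp: pure_tensor_def tensor_class_def tensor_subgroup_def r_coset_def
          intro: bexI[of _ 0])
    with 1 show ?thesis by blast
  qed
  then show ?thesis by (simp add: tensor_map_def)
qed

end

theory Submission
  imports Defs
begin

text \<open>The depth condition at the maximal ideal \<open>m\<close> gives \<open>a, b \<in> m\<close> regular on \<open>S\<close>; inside the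
  fraction field this says that \<open>a h, b h \<in> S\<close> forces \<open>h \<in> S\<close>. If \<open>a, b\<close> lay in a height one
  prime \<open>P\<close>, this would make \<open>a\<close> invertible on \<open>S\<^sub>P\<close>, against the depth condition at \<open>P\<close>; so
  \<open>a, b\<close> is a system of parameters, \<open>m S \<noteq> S\<close>, and every system of parameters is regular on
  \<open>S\<close>. The elements of the fraction field multiplied into \<open>R\<close> by powers of each element of \<open>m\<close>
  form an \<open>S\<^sub>2\<close> extension contained in \<open>S\<close>, so they are all of \<open>S\<close> by minimality. For a big
  Cohen--Macaulay module \<open>B\<close> and \<open>w \<in> B\<close> this description yields an \<open>R\<close>-linear map \<open>S \<rightarrow> B\<close>
  with \<open>1 \<mapsto> w\<close>, and tensoring with it carries membership in the closure from \<open>S\<close> to \<open>B\<close>.\<close>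

section \<open>Prime ideals and local rings\<close>

text \<open>The S_2-ification S is not known to be a finitely generated R-module, so Nakayama's
  lemma and the depth theory of finite modules are out of reach. That a regular pair in m generates
  an ideal with radical m, and that m S is proper, is therefore obtained from prime ideals: of R in
  the one case, of the ring S in the other. The depth condition at P is posed over R_P, a subring of
  K acting through the identity map. For this reason regularity is studied for an arbitrary domain
  with fraction field K and then applied both to R with \<open>\<phi>\<close> and to R_P with the
  identity. The description of S by powers comes from ideals of height two: in a local ring of
  dimension two only m lies above such an ideal, so it contains a power of every element of m.
  Regularity of a system of parameters on B is exactly what permits division by such powers, which
  is why the same construction of maps works for every big Cohen--Macaulay module.\<close>

lemma (in cring) exists_maximal_avoiding:
  assumes I: "ideal I R" "I \<inter> W = {}"
  obtains P where "ideal P R" "I \<subseteq> P" "P \<inter> W = {}"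
    and "\<And>J. ideal J R \<Longrightarrow> P \<subseteq> J \<Longrightarrow> J \<inter> W = {} \<Longrightarrow> J = P"
proof -
  let ?A = "{J. ideal J R \<and> I \<subseteq> J \<and> J \<inter> W = {}}"
  have "\<exists>P\<in>?A. \<forall>J\<in>?A. P \<subseteq> J \<longrightarrow> J = P"
  proof (rule subset_Zorn_nonempty)
    show "?A \<noteq> {}" using I by blast
    fix C assume C: "C \<noteq> {}" "subset.chain ?A C"
    then have sub: "C \<subseteq> ?A" by (simp add: pred_on.chain_def)
    have "subset.chain {J. ideal J R} C" using C(2) sub by (auto simp: pred_on.chain_def)
    then have "ideal (\<Union>C) R" using chain_Union_is_ideal[of C] C(1) by simp
    moreover have "I \<subseteq> \<Union>C" "\<Union>C \<inter> W = {}"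
      using C(1) sub by fast+
    ultimately show "\<Union>C \<in> ?A" by blast
  qed
  then obtain P where P: "P \<in> ?A" and max: "\<forall>J\<in>?A. P \<subseteq> J \<longrightarrow> J = P" by blast
  have "J = P" if J: "ideal J R" "P \<subseteq> J" "J \<inter> W = {}" for J
  proof -
    have "I \<subseteq> J" using P J(2) by auto
    then show ?thesis using max[rule_format, of J] J by simp
  qed
  then show thesis using that[of P] P by simp
qed

text \<open>If neither a nor b lay in the maximal choice P, both P + (a) and P + (b) would meet W.
  The product of the two meeting points is in W, but it is a multiple of a b modulo P and so would
  lie in P.\<close>

lemma (in cring) exists_prime_avoiding:
  assumes I: "ideal I R" "I \<inter> W = {}"
    and W: "W \<subseteq> carrier R" "\<one> \<in> W" "\<And>v w. v \<in> W \<Longrightarrow> w \<in> W \<Longrightarrow> v \<otimes> w \<in> W"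
  obtains P where "primeideal P R" "I \<subseteq> P" "P \<inter> W = {}"
proof -
  obtain P where P: "ideal P R" "I \<subseteq> P" "P \<inter> W = {}"
    and max: "\<And>J. ideal J R \<Longrightarrow> P \<subseteq> J \<Longrightarrow> J \<inter> W = {} \<Longrightarrow> J = P"
    using exists_maximal_avoiding[OF I] by metis
  interpret P: ideal P R by fact
  have meets: "\<exists>w\<in>W. \<exists>p\<in>P. \<exists>r\<in>carrier R. w = p \<oplus> r \<otimes> a" if a: "a \<in> carrier R" "a \<notin> P" for a
  proof -
    let ?J = "set_add R P (PIdl a)"
    have J: "ideal ?J R" using add_ideals[OF P(1) cgenideal_ideal[OF a(1)]] .
    have mem: "x \<in> ?J \<longleftrightarrow> (\<exists>p\<in>P. \<exists>r\<in>carrier R. x = p \<oplus> r \<otimes> a)" for x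
      by (auto simp: set_add_def' cgenideal_def)
    have "P \<subseteq> ?J"
    proof
      fix p assume "p \<in> P"
      then show "p \<in> ?J" unfolding mem using a(1) by (intro bexI[of _ p] bexI[of _ \<zero>]) auto
    qed
    moreover have "a \<in> ?J"
      unfolding mem using a(1) by (intro bexI[of _ \<zero>] bexI[of _ \<one>]) auto
    ultimately have "?J \<inter> W \<noteq> {}" using max[OF J] a(2) by blast
    then show ?thesis using mem by blast
  qed
  have "primeideal P R"
  proof (rule primeidealI[OF P(1) is_cring])
    show "carrier R \<noteq> P" using P(3) W(2) by auto
    fix a b assume ab: "a \<in> carrier R" "b \<in> carrier R" "a \<otimes> b \<in> P"
    show "a \<in> P \<or> b \<in> P"
    proof (rule ccontr)
      assume "\<not> (a \<in> P \<or> b \<in> P)"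
      then obtain v w p q r s where vw: "v \<in> W" "w \<in> W" "p \<in> P" "q \<in> P" "r \<in> carrier R" "s \<in> carrier R"
          "v = p \<oplus> r \<otimes> a" "w = q \<oplus> s \<otimes> b"
        using meets[OF ab(1)] meets[OF ab(2)] by blast
      have [simp]: "p \<in> carrier R" "q \<in> carrier R" using vw(3,4) by auto
      have "v \<otimes> w = (p \<otimes> w \<oplus> (r \<otimes> a) \<otimes> q) \<oplus> (r \<otimes> s) \<otimes> (a \<otimes> b)"
        unfolding vw(7,8) using ab(1,2) vw(5,6) by (simp add: l_distr r_distr a_ac m_ac)
      also have "\<dots> \<in> P"
      proof -
        have "w \<in> carrier R" "r \<otimes> a \<in> carrier R" "r \<otimes> s \<in> carrier R"
          using vw(2,5,6) W(1) ab(1) by auto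
        then show ?thesis
          using vw(3,4) ab(3) by (intro P.a_closed P.I_l_closed[OF vw(4)] P.I_r_closed[OF vw(3)] P.I_l_closed[OF ab(3)])
      qed
      finally show False using W(3)[OF vw(1,2)] P(3) by blast
    qed
  qed
  then show thesis using that P by blast
qed

lemma primeideal_one_notin:
  assumes "primeideal P R"
  shows "\<one>\<^bsub>R\<^esub> \<notin> P"
  using assms ideal.one_imp_carrier[of P R] primeideal.I_notcarr[of P R]
  by (auto simp: primeideal_def)

lemma primeideal_pow_mem:
  assumes P: "primeideal P R" and a: "a \<in> carrier R" "a [^]\<^bsub>R\<^esub> (n::nat) \<in> P"
  shows "a \<in> P"
proof -
  interpret primeideal P R by fact
  show ?thesis using a(2)
  proof (induction n)
    case 0
    then show ?case using primeideal_one_notin[OF P] by simp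
  next
    case (Suc n)
    then show ?case using I_prime[of "a [^]\<^bsub>R\<^esub> n" a] a(1) by auto
  qed
qed

text \<open>If no power of c were in I, some prime above I would avoid all powers of c, contrary to
  the hypothesis on primes.\<close>

lemma radical_memI:
  assumes "cring R" and I: "ideal I R" and c: "c \<in> carrier R"
    and P: "\<And>P. primeideal P R \<Longrightarrow> I \<subseteq> P \<Longrightarrow> c \<in> P"
  shows "c \<in> radical R I"
proof (rule ccontr)
  interpret cring R by fact
  assume notin: "c \<notin> radical R I"
  let ?W = "range (\<lambda>n::nat. c [^]\<^bsub>R\<^esub> n)"
  have "I \<inter> ?W = {}" using notin c by (auto simp: radical_def)
  moreover have "?W \<subseteq> carrier R" "\<one>\<^bsub>R\<^esub> \<in> ?W"
    using c by (auto intro: range_eqI[of _ _ "0::nat"])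
  moreover have "v \<otimes>\<^bsub>R\<^esub> w \<in> ?W" if "v \<in> ?W" "w \<in> ?W" for v w
    using that c by (auto simp: nat_pow_mult)
  ultimately obtain Q where Q: "primeideal Q R" "I \<subseteq> Q" "Q \<inter> ?W = {}"
    using exists_prime_avoiding[OF I] by metis
  then have "c \<in> Q" using P by blast
  moreover have "c [^]\<^bsub>R\<^esub> (1::nat) \<in> ?W" by blast
  ultimately show False using Q(3) c by auto
qed

section \<open>Local rings and their maximal ideal\<close>

lemma max_ideal_maximalideal:
  assumes "local_ring R"
  shows "maximalideal (max_ideal R) R"
  using theI'[of "\<lambda>m. maximalideal m R"] assms by (simp add: local_ring_def max_ideal_def)

lemma max_ideal_primeideal:
  assumes "local_ring R"
  shows "primeideal (max_ideal R) R"
  using assms max_ideal_maximalideal[OF assms] cring.maximalideal_prime by (auto simp: local_ring_def)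

text \<open>Zorn's lemma with the set {1} to be avoided: an ideal that is maximal among those
  omitting 1 is a maximal ideal, and there is only one of these.\<close>

lemma proper_ideal_subset_max_ideal:
  assumes R: "local_ring R" and I: "ideal I R" "\<one>\<^bsub>R\<^esub> \<notin> I"
  shows "I \<subseteq> max_ideal R"
proof -
  interpret cring R using R by (simp add: local_ring_def)
  obtain P where P: "ideal P R" "I \<subseteq> P" "P \<inter> {\<one>\<^bsub>R\<^esub>} = {}"
    and max: "\<And>J. ideal J R \<Longrightarrow> P \<subseteq> J \<Longrightarrow> J \<inter> {\<one>\<^bsub>R\<^esub>} = {} \<Longrightarrow> J = P"
    using exists_maximal_avoiding[OF I(1), of "{\<one>\<^bsub>R\<^esub>}"] I(2) by auto
  have "maximalideal P R"
  proof (rule maximalidealI[OF P(1)])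
    show "carrier R \<noteq> P" using P(3) by auto
    fix J assume J: "ideal J R" "P \<subseteq> J"
    show "J = P \<or> J = carrier R"
      using max[OF J] ideal.one_imp_carrier[OF J(1)] by blast
  qed
  then have "P = max_ideal R"
    using R max_ideal_maximalideal[OF R] by (auto simp: local_ring_def)
  with P(2) show ?thesis by simp
qed

lemma prime_subset_max_ideal:
  assumes "local_ring R" "primeideal P R"
  shows "P \<subseteq> max_ideal R"
  using assms proper_ideal_subset_max_ideal primeideal_one_notin by (metis primeideal_def)

lemma unit_if_notin_max_ideal:
  assumes R: "local_ring R" and x: "x \<in> carrier R" "x \<notin> max_ideal R"
  obtains y where "y \<in> carrier R" "x \<otimes>\<^bsub>R\<^esub> y = \<one>\<^bsub>R\<^esub>"
proof -
  interpret cring R using R by (simp add: local_ring_def)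
  have "\<one>\<^bsub>R\<^esub> \<in> PIdl\<^bsub>R\<^esub> x"
    using proper_ideal_subset_max_ideal[OF R cgenideal_ideal[OF x(1)]] x cgenideal_self by blast
  then show thesis using that x(1) by (auto simp: cgenideal_def m_comm)
qed

section \<open>Chains of primes in a local domain of dimension two\<close>

text \<open>If all elements are below n, then n - 1 bounds the supremum. Positivity of n excludes
  the empty set, whose supremum is 0.\<close>

lemma Sup_enat_ge:
  assumes "enat n \<le> Sup A" "0 < n"
  shows "\<exists>x\<in>A. enat n \<le> x"
proof (rule ccontr)
  assume no: "\<not> (\<exists>x\<in>A. enat n \<le> x)"
  have "x \<le> enat (n - 1)" if x: "x \<in> A" for x
  proof -
    have "x < enat n" using no x by (auto simp: not_le)
    then show ?thesis using assms(2) by (cases x) auto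
  qed
  then have "Sup A \<le> enat (n - 1)" by (rule Sup_least)
  then have "enat n \<le> enat (n - 1)" using assms(1) by (rule order_trans[rotated])
  with assms(2) show False by simp
qed

lemma sorted_psubset_last:
  assumes "sorted_wrt (\<subset>) Ps" "Q \<in> set Ps"
  shows "Q \<subseteq> last Ps"
proof (cases "Q = last Ps")
  case False
  have "sorted_wrt (\<subset>) (butlast Ps @ [last Ps])" "Q \<in> set (butlast Ps @ [last Ps])"
    using assms by (cases "Ps = []"; simp)+
  with False show ?thesis unfolding sorted_wrt_append by auto
qed simp

lemma height_ge_1:
  assumes "domain R" "primeideal P R" "P \<noteq> {\<zero>\<^bsub>R\<^esub>}"
  shows "1 \<le> height R P"
proof -
  interpret domain R by fact
  interpret P: primeideal P R by fact
  have "{\<zero>\<^bsub>R\<^esub>} \<subset> P" using assms(3) P.zero_closed by blast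
  then have "prime_chain R [{\<zero>\<^bsub>R\<^esub>}, P]"
    using zeroprimeideal assms(2) by (simp add: prime_chain_def)
  then have "enat (length [{\<zero>\<^bsub>R\<^esub>}, P] - 1) \<le> height R P"
    unfolding height_def by (intro Sup_upper) force
  then show ?thesis by (simp add: one_enat_def)
qed

lemma prime_chain_bound:
  assumes "krull_dim R = enat d" "prime_chain R Ps"
  shows "length Ps \<le> Suc d"
proof -
  have "enat (length Ps - 1) \<le> krull_dim R"
    unfolding krull_dim_def using assms(2) by (intro Sup_upper) blast
  then show ?thesis using assms(1) by simp
qed

text \<open>A chain of maximal length that ended strictly below m could be prolonged by m, against
  the dimension; so it ends at m.\<close>

lemma height_max_ideal:
  assumes R: "local_ring R" and d: "krull_dim R = enat d" "0 < d"
  shows "krull_dim R \<le> height R (max_ideal R)"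
proof -
  have "enat d \<le> Sup {enat (length Ps - 1) | Ps. prime_chain R Ps}"
    using d(1) by (simp add: krull_dim_def)
  then obtain x where "x \<in> {enat (length Ps - 1) | Ps. prime_chain R Ps}" "enat d \<le> x"
    using Sup_enat_ge d(2) by blast
  then obtain Ps where Ps: "prime_chain R Ps" "d \<le> length Ps - 1" by auto
  have max: "last Ps = max_ideal R"
  proof (rule ccontr)
    assume ne: "last Ps \<noteq> max_ideal R"
    have "P \<subset> max_ideal R" if "P \<in> set Ps" for P
    proof -
      have "P \<subseteq> last Ps"
        using that Ps(1) sorted_psubset_last by (auto simp: prime_chain_def)
      moreover have "last Ps \<subseteq> max_ideal R"
        using prime_subset_max_ideal[OF R] Ps(1) by (auto simp: prime_chain_def)
      ultimately show ?thesis using ne by blast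
    qed
    then have "prime_chain R (Ps @ [max_ideal R])"
      using Ps(1) max_ideal_primeideal[OF R] by (auto simp: prime_chain_def sorted_wrt_append)
    from prime_chain_bound[OF d(1) this] show False using Ps(2) d(2) by simp
  qed
  then have "enat (length Ps - 1) \<le> height R (max_ideal R)"
    unfolding height_def using Ps(1) by (intro Sup_upper) blast
  moreover have "krull_dim R \<le> enat (length Ps - 1)" using Ps(2) d(1) by simp
  ultimately show ?thesis by (rule order_trans[rotated])
qed

lemma prime_chain_four:
  assumes "krull_dim R = 2" "domain R" "primeideal P R" "primeideal Q R" "primeideal M R"
    and "P \<noteq> {\<zero>\<^bsub>R\<^esub>}" "P \<subset> Q" "Q \<subset> M"
  shows False
proof -
  interpret domain R by fact
  interpret P: primeideal P R by fact
  have "{\<zero>\<^bsub>R\<^esub>} \<subset> P" using assms(6) P.zero_closed by blast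
  then have "prime_chain R [{\<zero>\<^bsub>R\<^esub>}, P, Q, M]"
    using assms zeroprimeideal by (auto simp: prime_chain_def)
  from prime_chain_bound[OF _ this, of 2] show False
    using assms(1) by (simp add: numeral_eq_enat)
qed

text \<open>Every chain ending at P is prolonged by m to a chain with at most three entries.\<close>

lemma height_le_1:
  assumes R: "local_ring R" "krull_dim R = 2" and P: "primeideal P R" "P \<noteq> max_ideal R"
  shows "height R P \<le> 1"
  unfolding height_def
proof (rule Sup_least, clarify)
  fix Ps assume Ps: "prime_chain R Ps" "P = last Ps"
  have lt: "last Ps \<subset> max_ideal R" using prime_subset_max_ideal[OF R(1) P(1)] P(2) Ps(2) by blast
  have "Q \<subset> max_ideal R" if "Q \<in> set Ps" for Q
  proof -
    have "Q \<subseteq> last Ps"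
      using that Ps(1) sorted_psubset_last by (auto simp: prime_chain_def)
    then show ?thesis using lt by blast
  qed
  then have "prime_chain R (Ps @ [max_ideal R])"
    using Ps(1) max_ideal_primeideal[OF R(1)] by (auto simp: prime_chain_def sorted_wrt_append)
  from prime_chain_bound[OF _ this, of 2] show "enat (length Ps - 1) \<le> 1"
    using R(2) by (simp add: numeral_eq_enat one_enat_def)
qed

lemma height_zero_ideal:
  assumes "domain R"
  shows "height R {\<zero>\<^bsub>R\<^esub>} = 0"
proof -
  have "length Ps = 1" if Ps: "prime_chain R Ps" "last Ps = {\<zero>\<^bsub>R\<^esub>}" for Ps
  proof (cases Ps)
    case (Cons Q Qs)
    have "\<zero>\<^bsub>R\<^esub> \<in> Q"
      using Ps(1) Cons
      by (auto simp: prime_chain_def primeideal_def ideal_def additive_subgroup.zero_closed)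
    moreover have "Q \<subset> last Qs" if "Qs \<noteq> []"
      using Ps(1) Cons that by (auto simp: prime_chain_def)
    ultimately show ?thesis using Ps(2) Cons by (cases "Qs = []") auto
  qed (use Ps(1) in \<open>simp add: prime_chain_def\<close>)
  then have "height R {\<zero>\<^bsub>R\<^esub>} \<le> 0"
    unfolding height_def by (intro Sup_least) (auto simp: zero_enat_def)
  then show ?thesis by simp
qed

section \<open>Regular sequences of length at most two\<close>

lemma generated_submodule_minimal:
  assumes "submodule N R M" "A \<subseteq> N"
  shows "generated_submodule R M A \<subseteq> N"
  using assms by (auto simp: generated_submodule_def)

lemma generated_submodule_superset: "A \<subseteq> generated_submodule R M A"
  by (auto simp: generated_submodule_def)

lemma generated_submodule_eqI:
  assumes "submodule N R M" "A \<subseteq> N" "\<And>N'. submodule N' R M \<Longrightarrow> A \<subseteq> N' \<Longrightarrow> N \<subseteq> N'"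
  shows "generated_submodule R M A = N"
  using assms unfolding generated_submodule_def by blast

lemma set_smult_mono:
  assumes "A \<subseteq> B"
  shows "set_smult R A M \<subseteq> set_smult R B M"
  using assms unfolding set_smult_def generated_submodule_def by blast

lemma (in module) set_smult_subset:
  assumes "A \<subseteq> carrier R"
  shows "set_smult R A M \<subseteq> carrier M"
  unfolding set_smult_def
  by (rule generated_submodule_minimal[OF carrier_is_submodule]) (use assms in auto)

lemma (in module) submodule_generated_submodule:
  assumes "A \<subseteq> carrier M"
  shows "submodule (generated_submodule R M A) R M"
proof (rule submoduleI)
  show "generated_submodule R M A \<subseteq> carrier M"
    by (rule generated_submodule_minimal[OF carrier_is_submodule assms])
  show "\<zero>\<^bsub>M\<^esub> \<in> generated_submodule R M A"
    by (auto simp: generated_submodule_def submodule_def dest: subgroup.one_closed)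
qed (auto simp: generated_submodule_def submoduleE(3,4,5))

lemma (in module) submodule_set_smult:
  assumes "A \<subseteq> carrier R"
  shows "submodule (set_smult R A M) R M"
  unfolding set_smult_def by (rule submodule_generated_submodule) (use assms in auto)

lemma (in module) set_smult_empty: "set_smult R {} M = {\<zero>\<^bsub>M\<^esub>}"
  unfolding set_smult_def
proof (rule generated_submodule_eqI)
  show "submodule {\<zero>\<^bsub>M\<^esub>} R M" by (rule submoduleI) auto
  show "{\<zero>\<^bsub>M\<^esub>} \<subseteq> N'" if "submodule N' R M" for N'
    using that by (auto simp: submodule_def dest: subgroup.one_closed)
qed auto

lemma (in module) set_smult_pair:
  assumes x: "x \<in> carrier R" and y: "y \<in> carrier R"
  shows "set_smult R {x, y} M =
    {x \<odot>\<^bsub>M\<^esub> v \<oplus>\<^bsub>M\<^esub> y \<odot>\<^bsub>M\<^esub> w | v w. v \<in> carrier M \<and> w \<in> carrier M}"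
    (is "_ = ?N")
  unfolding set_smult_def
proof (rule generated_submodule_eqI)
  show "submodule ?N R M"
  proof (rule submoduleI)
    show "?N \<subseteq> carrier M" using x y by auto
    show "\<zero>\<^bsub>M\<^esub> \<in> ?N" using x y by (auto intro!: exI[of _ "\<zero>\<^bsub>M\<^esub>"])
    show "\<ominus>\<^bsub>M\<^esub> a \<in> ?N" if a: "a \<in> ?N" for a
    proof -
      obtain v w where "v \<in> carrier M" "w \<in> carrier M" "a = x \<odot>\<^bsub>M\<^esub> v \<oplus>\<^bsub>M\<^esub> y \<odot>\<^bsub>M\<^esub> w"
        using a by auto
      then show ?thesis using x y
        by (intro CollectI exI[of _ "\<ominus>\<^bsub>M\<^esub> v"] exI[of _ "\<ominus>\<^bsub>M\<^esub> w"])
          (simp add: smult_r_minus M.minus_add)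
    qed
    show "a \<oplus>\<^bsub>M\<^esub> b \<in> ?N" if ab: "a \<in> ?N" "b \<in> ?N" for a b
    proof -
      obtain v w where 1: "v \<in> carrier M" "w \<in> carrier M" "a = x \<odot>\<^bsub>M\<^esub> v \<oplus>\<^bsub>M\<^esub> y \<odot>\<^bsub>M\<^esub> w"
        using ab by auto
      obtain v' w' where 2: "v' \<in> carrier M" "w' \<in> carrier M" "b = x \<odot>\<^bsub>M\<^esub> v' \<oplus>\<^bsub>M\<^esub> y \<odot>\<^bsub>M\<^esub> w'"
        using ab by auto
      show ?thesis using x y 1 2
        by (intro CollectI exI[of _ "v \<oplus>\<^bsub>M\<^esub> v'"] exI[of _ "w \<oplus>\<^bsub>M\<^esub> w'"])
          (simp add: smult_r_distr M.a_ac)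
    qed
    show "r \<odot>\<^bsub>M\<^esub> a \<in> ?N" if r: "r \<in> carrier R" and a: "a \<in> ?N" for r a
    proof -
      obtain v w where 1: "v \<in> carrier M" "w \<in> carrier M" "a = x \<odot>\<^bsub>M\<^esub> v \<oplus>\<^bsub>M\<^esub> y \<odot>\<^bsub>M\<^esub> w"
        using a by auto
      have "r \<odot>\<^bsub>M\<^esub> a = x \<odot>\<^bsub>M\<^esub> (r \<odot>\<^bsub>M\<^esub> v) \<oplus>\<^bsub>M\<^esub> y \<odot>\<^bsub>M\<^esub> (r \<odot>\<^bsub>M\<^esub> w)"
        using x y r 1 by (simp add: smult_r_distr flip: smult_assoc1) (simp add: R.m_comm)
      then show ?thesis using r 1 by blast
    qed
  qed
  show "{a \<odot>\<^bsub>M\<^esub> v |a v. a \<in> {x, y} \<and> v \<in> carrier M} \<subseteq> ?N"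
  proof clarify
    fix a v assume av: "a \<in> {x, y}" "v \<in> carrier M"
    have "x \<odot>\<^bsub>M\<^esub> v = x \<odot>\<^bsub>M\<^esub> v \<oplus>\<^bsub>M\<^esub> y \<odot>\<^bsub>M\<^esub> \<zero>\<^bsub>M\<^esub>" "y \<odot>\<^bsub>M\<^esub> v = x \<odot>\<^bsub>M\<^esub> \<zero>\<^bsub>M\<^esub> \<oplus>\<^bsub>M\<^esub> y \<odot>\<^bsub>M\<^esub> v"
      using x y av by auto
    then show "\<exists>v' w. a \<odot>\<^bsub>M\<^esub> v = x \<odot>\<^bsub>M\<^esub> v' \<oplus>\<^bsub>M\<^esub> y \<odot>\<^bsub>M\<^esub> w \<and> v' \<in> carrier M \<and> w \<in> carrier M"
      using av M.zero_closed by blast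
  qed
  show "?N \<subseteq> N'" if "submodule N' R M" "{a \<odot>\<^bsub>M\<^esub> v |a v. a \<in> {x, y} \<and> v \<in> carrier M} \<subseteq> N'" for N'
    using that submoduleE(5)[OF that(1)] by blast
qed

lemma (in module) set_smult_singleton:
  assumes x: "x \<in> carrier R"
  shows "set_smult R {x} M = (\<lambda>v. x \<odot>\<^bsub>M\<^esub> v) ` carrier M"
proof -
  have "x \<odot>\<^bsub>M\<^esub> v \<oplus>\<^bsub>M\<^esub> x \<odot>\<^bsub>M\<^esub> w \<in> (\<lambda>v. x \<odot>\<^bsub>M\<^esub> v) ` carrier M"
    if "v \<in> carrier M" "w \<in> carrier M" for v w
    using that x by (intro image_eqI[of _ _ "v \<oplus>\<^bsub>M\<^esub> w"]) (simp_all add: smult_r_distr)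
  \<comment> \<open>The formula for two generators is used with both equal to x.\<close>
  then have "set_smult R {x} M \<subseteq> (\<lambda>v. x \<odot>\<^bsub>M\<^esub> v) ` carrier M"
    using set_smult_pair[OF x x] by auto
  moreover have "(\<lambda>v. x \<odot>\<^bsub>M\<^esub> v) ` carrier M \<subseteq> set_smult R {x} M"
    unfolding set_smult_def by (rule order_trans[OF _ generated_submodule_superset]) auto
  ultimately show ?thesis by (rule equalityI)
qed

text \<open>Only properness is at stake: a prefix generates a smaller submodule than the full
  sequence.\<close>

lemma regular_sequence_take:
  assumes "module R M" and xs: "regular_sequence R M xs"
  shows "regular_sequence R M (take n xs)"
proof -
  interpret module R M by fact
  have "set (take n xs) \<subseteq> set xs" by (rule set_take_subset)
  then have "set_smult R (set (take n xs)) M \<subseteq> set_smult R (set xs) M" by (rule set_smult_mono)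
  moreover have "set_smult R (set xs) M \<subset> carrier M"
    using xs set_smult_subset[of "set xs"] by (auto simp: regular_sequence_def)
  ultimately have "set_smult R (set (take n xs)) M \<noteq> carrier M" by blast
  then show ?thesis
    using xs \<open>set (take n xs) \<subseteq> set xs\<close> by (auto simp: regular_sequence_def)
qed

lemma (in module) regular_sequence_singleton:
  "regular_sequence R M [x] \<longleftrightarrow>
     x \<in> carrier R \<and> (\<forall>v\<in>carrier M. x \<odot>\<^bsub>M\<^esub> v = \<zero>\<^bsub>M\<^esub> \<longrightarrow> v = \<zero>\<^bsub>M\<^esub>) \<and>
     set_smult R {x} M \<noteq> carrier M"
  by (auto simp: regular_sequence_def set_smult_empty)

lemma (in module) regular_sequence_pair:
  "regular_sequence R M [x, y] \<longleftrightarrow>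
     x \<in> carrier R \<and> y \<in> carrier R \<and> (\<forall>v\<in>carrier M. x \<odot>\<^bsub>M\<^esub> v = \<zero>\<^bsub>M\<^esub> \<longrightarrow> v = \<zero>\<^bsub>M\<^esub>) \<and>
     (\<forall>v\<in>carrier M. \<forall>w\<in>carrier M. y \<odot>\<^bsub>M\<^esub> v = x \<odot>\<^bsub>M\<^esub> w \<longrightarrow> (\<exists>w'\<in>carrier M. v = x \<odot>\<^bsub>M\<^esub> w')) \<and>
     set_smult R {x, y} M \<noteq> carrier M"
proof -
  have "(\<forall>i < length [x, y]. P i) \<longleftrightarrow> P 0 \<and> P 1" for P :: "nat \<Rightarrow> bool"
    by (auto simp: less_Suc_eq)
  then show ?thesis
    unfolding regular_sequence_def
    by (cases "x \<in> carrier R") (auto simp: set_smult_empty set_smult_singleton)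
qed

text \<open>Depth is a supremum of lengths, so it yields a sequence of length at least n; truncation
  makes the length exactly n.\<close>

lemma depth_ge_regular_sequence:
  assumes M: "module R M" and n: "enat n \<le> depth R I M" "0 < n"
  obtains xs where "length xs = n" "set xs \<subseteq> I" "regular_sequence R M xs"
proof -
  obtain d where d: "d \<in> {enat (length xs) | xs. set xs \<subseteq> I \<and> regular_sequence R M xs}" "enat n \<le> d"
    using Sup_enat_ge[OF n[unfolded depth_def]] by blast
  then obtain xs where xs: "set xs \<subseteq> I" "regular_sequence R M xs" "n \<le> length xs" by auto
  show thesis
  proof (rule that)
    show "length (take n xs) = n" using xs(3) by simp
    show "set (take n xs) \<subseteq> I" using xs(1) set_take_subset[of n xs] by blast
    show "regular_sequence R M (take n xs)" by (rule regular_sequence_take[OF M xs(2)])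
  qed
qed

lemma depth_ge:
  assumes "set xs \<subseteq> I" "regular_sequence R M xs"
  shows "enat (length xs) \<le> depth R I M"
  unfolding depth_def using assms by (intro Sup_upper) blast

section \<open>Module closures under linear maps\<close>

lemma tensor_relators_carrier:
  assumes "module R A" "module R M"
  shows "tensor_relators R A M \<subseteq> carrier (free_Abelian_group (carrier A \<times> carrier M))"
proof -
  interpret A: module R A by fact
  interpret M: module R M by fact
  show ?thesis by (auto simp: tensor_relators_def dest!: keys_diff[THEN subsetD])
qed

lemma subgroup_tensor_subgroup:
  assumes "module R A" "module R M"
  shows "subgroup (tensor_subgroup R A M) (free_Abelian_group (carrier A \<times> carrier M))"
  unfolding tensor_subgroup_def
  by (rule group.generate_is_subgroup[OF group_free_Abelian_group tensor_relators_carrier[OF assms]])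

text \<open>Since \<open>frag_extend f\<close> is additive and the subgroup is generated by the
  relators, only relators have to be checked. It serves both for the inclusion of N in M, where f is
  \<open>frag_of\<close>, and for a linear map in the first factor.\<close>

lemma frag_extend_tensor_subgroup:
  assumes AM: "module R A" "module R M" and BN: "module R B" "module R N"
    and rel: "\<And>h. h \<in> tensor_relators R A M \<Longrightarrow> frag_extend f h \<in> tensor_subgroup R B N"
    and z: "z \<in> tensor_subgroup R A M"
  shows "frag_extend f z \<in> tensor_subgroup R B N"
proof -
  let ?F = "free_Abelian_group (carrier B \<times> carrier N)"
  interpret H: subgroup "tensor_subgroup R B N" ?F by (rule subgroup_tensor_subgroup[OF BN])
  show ?thesis
    using z unfolding tensor_subgroup_def[of R A]
  proof (induction rule: generate.induct)
    case one
    then show ?case using H.one_closed by simp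
  next
    case (incl h)
    then show ?case by (rule rel)
  next
    case (inv h)
    then have "Poly_Mapping.keys h \<subseteq> carrier A \<times> carrier M"
      using subsetD[OF tensor_relators_carrier[OF AM] inv] by simp
    moreover have "inv\<^bsub>?F\<^esub> frag_extend f h \<in> tensor_subgroup R B N"
      by (rule subgroup.m_inv_closed[OF H.subgroup_axioms rel[OF inv]])
    moreover have "Poly_Mapping.keys (frag_extend f h) \<subseteq> carrier B \<times> carrier N"
      using H.mem_carrier[OF rel[OF inv]] by simp
    ultimately show ?case by (simp add: frag_extend_minus)
  next
    case (eng h1 h2)
    then show ?case using H.m_closed by (simp add: frag_extend_add)
  qed
qed

lemma tensor_class_eq_iff:
  assumes AM: "module R A" "module R M"
    and z: "Poly_Mapping.keys z \<subseteq> carrier A \<times> carrier M"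
    and z': "Poly_Mapping.keys z' \<subseteq> carrier A \<times> carrier M"
  shows "tensor_class R A M z = tensor_class R A M z' \<longleftrightarrow> z - z' \<in> tensor_subgroup R A M"
proof -
  let ?F = "free_Abelian_group (carrier A \<times> carrier M)" and ?H = "tensor_subgroup R A M"
  interpret F: comm_group ?F by (rule abelian_free_Abelian_group)
  note H = subgroup_tensor_subgroup[OF AM]
  have mem: "w \<in> ?H #>\<^bsub>?F\<^esub> y \<longleftrightarrow> w - y \<in> ?H" for w y
    by (auto simp: r_coset_def intro: bexI[of _ "w - y"])
  show ?thesis
  proof
    assume "tensor_class R A M z = tensor_class R A M z'"
    moreover have "z \<in> ?H #>\<^bsub>?F\<^esub> z" using subgroup.one_closed[OF H] by (simp add: mem)
    ultimately show "z - z' \<in> ?H" unfolding tensor_class_def by (simp add: mem[symmetric])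
  next
    assume "z - z' \<in> ?H"
    then have "z \<in> ?H #>\<^bsub>?F\<^esub> z'" by (simp add: mem)
    then show "tensor_class R A M z = tensor_class R A M z'"
      unfolding tensor_class_def by (rule F.repr_independence[OF _ _ H, symmetric]) (use z' in simp)
  qed
qed

text \<open>The \<open>the_elem\<close> in \<open>tensor_map\<close> is meaningful because all
  representatives of a class over N fall into one class over M: every relator for N is a relator for
  M.\<close>

lemma tensor_map_tensor_class:
  assumes A: "module R A" and M: "module R M" and N: "submodule N R M"
    and z: "Poly_Mapping.keys z \<subseteq> carrier A \<times> N"
  shows "tensor_map R A M (\<lambda>v. v) (tensor_class R A (M\<lparr>carrier := N\<rparr>) z) = tensor_class R A M z"
proof -
  let ?N = "M\<lparr>carrier := N\<rparr>"
  interpret M: module R M by fact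
  have NM: "N \<subseteq> carrier M" using M.submoduleE(1)[OF N] .
  have N': "module R ?N" using submodule.submodule_is_module[OF N M] .
  note H' = subgroup_tensor_subgroup[OF A N']
  have "tensor_relators R A ?N \<subseteq> tensor_relators R A M"
    unfolding tensor_relators_def using NM by (intro Un_mono) auto
  then have sub: "h \<in> tensor_subgroup R A M" if "h \<in> tensor_subgroup R A ?N" for h
    using frag_extend_tensor_subgroup[OF A N' A M _ that, of frag_of]
    by (auto simp: frag_expansion[symmetric] tensor_subgroup_def intro: generate.incl)
  let ?f = "\<lambda>z. tensor_class R A M (frag_extend (\<lambda>(a, v). frag_of (a, v)) z)"
  have "?f y = tensor_class R A M z" if y: "y \<in> tensor_class R A ?N z" for y
  proof -
    obtain h where h: "h \<in> tensor_subgroup R A ?N" "y = h + z"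
      using y by (auto simp: tensor_class_def r_coset_def)
    have "Poly_Mapping.keys h \<subseteq> carrier A \<times> N" using subgroup.mem_carrier[OF H' h(1)] by simp
    then have "Poly_Mapping.keys y \<subseteq> carrier A \<times> carrier M"
      using z NM keys_add[of h z] unfolding h(2) by blast
    moreover have "Poly_Mapping.keys z \<subseteq> carrier A \<times> carrier M" using z NM by blast
    ultimately show ?thesis
      unfolding frag_extend_pairs using tensor_class_eq_iff[OF A M] sub[OF h(1)] h(2) by simp
  qed
  moreover have "z \<in> tensor_class R A ?N z"
    using subgroup.one_closed[OF H'] by (auto simp: tensor_class_def r_coset_def intro: bexI[of _ 0])
  ultimately have "?f ` tensor_class R A ?N z = {tensor_class R A M z}" by blast
  then show ?thesis by (simp add: tensor_map_def)
qed

text \<open>Elements of the image are classes of formal sums of pairs with second entry in N.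
  Membership thus becomes a congruence between formal sums, and no quotient group appears in the
  transport along linear maps.\<close>

lemma module_closure_image_iff:
  assumes A: "module R A" and M: "module R M" and N: "submodule N R M"
    and s: "s \<in> carrier A" and u: "u \<in> carrier M"
  shows "pure_tensor R A M s u
          \<in> tensor_map R A M (\<lambda>v. v) ` carrier (tensor_product R A (M\<lparr>carrier := N\<rparr>)) \<longleftrightarrow>
    (\<exists>z. Poly_Mapping.keys z \<subseteq> carrier A \<times> N \<and> frag_of (s, u) - z \<in> tensor_subgroup R A M)"
proof -
  interpret M: module R M by fact
  have NM: "N \<subseteq> carrier M" using M.submoduleE(1)[OF N] .
  have "carrier (tensor_product R A (M\<lparr>carrier := N\<rparr>)) =
      tensor_class R A (M\<lparr>carrier := N\<rparr>) ` {z. Poly_Mapping.keys z \<subseteq> carrier A \<times> N}"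
    by (auto simp: tensor_product_def FactGroup_def RCOSETS_def tensor_class_def)
  then have img: "tensor_map R A M (\<lambda>v. v) ` carrier (tensor_product R A (M\<lparr>carrier := N\<rparr>)) =
      tensor_class R A M ` {z. Poly_Mapping.keys z \<subseteq> carrier A \<times> N}"
    using tensor_map_tensor_class[OF A M N] by (auto simp: image_image)
  have "pure_tensor R A M s u = tensor_class R A M z \<longleftrightarrow>
      frag_of (s, u) - z \<in> tensor_subgroup R A M" if "Poly_Mapping.keys z \<subseteq> carrier A \<times> N" for z
    unfolding pure_tensor_def
    by (rule tensor_class_eq_iff[OF A M]) (use that NM s u in \<open>auto simp: keys_frag_of\<close>)
  then show ?thesis unfolding img image_iff by blast
qed

text \<open>A linear map with \<open>s \<mapsto> b\<close> carries the relation witnessing \<open>s \<otimes> u \<in> im (A \<otimes> N)\<close>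
  to one for \<open>b \<otimes> u\<close>.\<close>

lemma module_closure_mono:
  assumes A: "module R A" and B: "module R B" and M: "module R M" and N: "submodule N R M"
    and maps: "\<And>b. b \<in> carrier B \<Longrightarrow> \<exists>f s. s \<in> carrier A \<and> f s = b \<and> f \<in> carrier A \<rightarrow> carrier B \<and>
       (\<forall>x\<in>carrier A. \<forall>y\<in>carrier A. f (x \<oplus>\<^bsub>A\<^esub> y) = f x \<oplus>\<^bsub>B\<^esub> f y) \<and>
       (\<forall>r\<in>carrier R. \<forall>x\<in>carrier A. f (r \<odot>\<^bsub>A\<^esub> x) = r \<odot>\<^bsub>B\<^esub> f x)"
  shows "module_closure R A M N \<subseteq> module_closure R B M N"
proof
  interpret A: module R A by fact
  interpret M: module R M by fact
  fix u assume u: "u \<in> module_closure R A M N"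
  then have uM: "u \<in> carrier M" by (simp add: module_closure_def)
  have "\<exists>z. Poly_Mapping.keys z \<subseteq> carrier B \<times> N \<and> frag_of (b, u) - z \<in> tensor_subgroup R B M"
    if b: "b \<in> carrier B" for b
  proof -
    obtain f s where s: "s \<in> carrier A" "f s = b" and f: "f \<in> carrier A \<rightarrow> carrier B"
      and add: "\<And>x y. x \<in> carrier A \<Longrightarrow> y \<in> carrier A \<Longrightarrow> f (x \<oplus>\<^bsub>A\<^esub> y) = f x \<oplus>\<^bsub>B\<^esub> f y"
      and smult: "\<And>r x. r \<in> carrier R \<Longrightarrow> x \<in> carrier A \<Longrightarrow> f (r \<odot>\<^bsub>A\<^esub> x) = r \<odot>\<^bsub>B\<^esub> f x"
      using maps[OF b] by blast
    obtain z where z: "Poly_Mapping.keys z \<subseteq> carrier A \<times> N" "frag_of (s, u) - z \<in> tensor_subgroup R A M"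
      using u s(1) uM module_closure_image_iff[OF A M N s(1) uM] by (auto simp: module_closure_def)
    let ?F = "frag_extend (\<lambda>(a, v). frag_of (f a, v))"
    have fB: "f a \<in> carrier B" if "a \<in> carrier A" for a using f that by blast
    have "?F h \<in> tensor_relators R B M" if "h \<in> tensor_relators R A M" for h
      using that unfolding tensor_relators_def[of R A]
    proof (elim UnE CollectE exE conjE)
      fix a a' v assume "h = frag_of (a \<oplus>\<^bsub>A\<^esub> a', v) - frag_of (a, v) - frag_of (a', v)"
        "a \<in> carrier A" "a' \<in> carrier A" "v \<in> carrier M"
      then show "?F h \<in> tensor_relators R B M"
        using fB unfolding tensor_relators_def by (simp add: frag_extend_diff add) blast
    next
      fix a v v' assume "h = frag_of (a, v \<oplus>\<^bsub>M\<^esub> v') - frag_of (a, v) - frag_of (a, v')"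
        "a \<in> carrier A" "v \<in> carrier M" "v' \<in> carrier M"
      then show "?F h \<in> tensor_relators R B M"
        using fB unfolding tensor_relators_def by (simp add: frag_extend_diff) blast
    next
      fix r a v assume "h = frag_of (r \<odot>\<^bsub>A\<^esub> a, v) - frag_of (a, r \<odot>\<^bsub>M\<^esub> v)"
        "r \<in> carrier R" "a \<in> carrier A" "v \<in> carrier M"
      then show "?F h \<in> tensor_relators R B M"
        using fB unfolding tensor_relators_def by (simp add: frag_extend_diff smult) blast
    qed
    then have "?F h \<in> tensor_subgroup R B M" if "h \<in> tensor_relators R A M" for h
      using that by (auto simp: tensor_subgroup_def intro: generate.incl)
    then have "?F (frag_of (s, u) - z) \<in> tensor_subgroup R B M"
      using frag_extend_tensor_subgroup[OF A M B M _ z(2)] by blast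
    then have "frag_of (b, u) - ?F z \<in> tensor_subgroup R B M"
      using s(2) by (simp add: frag_extend_diff)
    moreover have "Poly_Mapping.keys (?F z) \<subseteq> carrier B \<times> N"
    proof
      fix p assume "p \<in> Poly_Mapping.keys (?F z)"
      then obtain q where "q \<in> Poly_Mapping.keys z"
          "p \<in> Poly_Mapping.keys (case q of (a, v) \<Rightarrow> frag_of (f a, v))"
        using subsetD[OF keys_frag_extend] by fast
      then show "p \<in> carrier B \<times> N" using z(1) fB by (cases q) (auto simp: keys_frag_of)
    qed
    ultimately show ?thesis by blast
  qed
  then show "u \<in> module_closure R B M N"
    unfolding module_closure_def using module_closure_image_iff[OF B M N _ uM] uM by blast
qed

section \<open>Modules inside the fraction field\<close>

locale frac_field =
  fixes R :: "('a, 'r) ring_scheme" and K :: "('k, 's) ring_scheme" and \<phi> :: "'a \<Rightarrow> 'k"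
  assumes fraction_field: "fraction_field R K \<phi>"

sublocale frac_field \<subseteq> R: domain R
  using fraction_field by (simp add: fraction_field_def)

sublocale frac_field \<subseteq> K: field K
  using fraction_field by (simp add: fraction_field_def)

sublocale frac_field \<subseteq> hom: ring_hom_cring R K \<phi>
  using fraction_field
  by unfold_locales (simp add: fraction_field_def)

context frac_field
begin

text \<open>This is \<open>S2_extension\<close> without the depth condition. Localizing an overring
  of R gives an overring of R as well as of R_P.\<close>

definition overring :: "'k set \<Rightarrow> bool" where
  "overring T \<longleftrightarrow> subring T K \<and> \<phi> ` carrier R \<subseteq> T"

lemma phi_eq_iff: "a \<in> carrier R \<Longrightarrow> b \<in> carrier R \<Longrightarrow> \<phi> a = \<phi> b \<longleftrightarrow> a = b"
  using fraction_field by (auto simp: fraction_field_def inj_on_def)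

lemma phi_eq_zero_iff: "a \<in> carrier R \<Longrightarrow> \<phi> a = \<zero>\<^bsub>K\<^esub> \<longleftrightarrow> a = \<zero>\<^bsub>R\<^esub>"
  using phi_eq_iff[of a "\<zero>\<^bsub>R\<^esub>"] by simp

lemma K_inv: "z \<in> carrier K \<Longrightarrow> z \<noteq> \<zero>\<^bsub>K\<^esub> \<Longrightarrow> inv\<^bsub>K\<^esub> z \<in> carrier K \<and> z \<otimes>\<^bsub>K\<^esub> inv\<^bsub>K\<^esub> z = \<one>\<^bsub>K\<^esub>"
  using K.field_Units by auto

lemma K_div_cancel:
  assumes "z \<in> carrier K" "z \<noteq> \<zero>\<^bsub>K\<^esub>" "w \<in> carrier K"
  shows "z \<otimes>\<^bsub>K\<^esub> (w \<otimes>\<^bsub>K\<^esub> inv\<^bsub>K\<^esub> z) = w"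
  using K_inv[OF assms(1,2)] assms by (simp add: K.m_lcomm)

lemma overringD:
  assumes "overring T"
  shows "T \<subseteq> carrier K" "\<And>r. r \<in> carrier R \<Longrightarrow> \<phi> r \<in> T"
    and "\<zero>\<^bsub>K\<^esub> \<in> T" "\<one>\<^bsub>K\<^esub> \<in> T"
    and "\<And>s. s \<in> T \<Longrightarrow> \<ominus>\<^bsub>K\<^esub> s \<in> T"
    and "\<And>s t. s \<in> T \<Longrightarrow> t \<in> T \<Longrightarrow> s \<otimes>\<^bsub>K\<^esub> t \<in> T"
    and "\<And>s t. s \<in> T \<Longrightarrow> t \<in> T \<Longrightarrow> s \<oplus>\<^bsub>K\<^esub> t \<in> T"
  using assms unfolding overring_def by (auto dest: subringE)

lemma overring_carrier: "overring T \<Longrightarrow> t \<in> T \<Longrightarrow> t \<in> carrier K"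
  using overringD(1) by blast

lemma overring_phi_image: "overring (\<phi> ` carrier R)"
  unfolding overring_def using hom.ring.img_is_subring[OF R.carrier_is_subring] by simp

lemma module_overring: "overring T \<Longrightarrow> module R (module_in K \<phi> T)"
  unfolding overring_def using module_in_module[OF fraction_field] by blast

lemma module_in_simps [simp]:
  "carrier (module_in K \<phi> T) = T"
  "\<zero>\<^bsub>module_in K \<phi> T\<^esub> = \<zero>\<^bsub>K\<^esub>"
  "s \<oplus>\<^bsub>module_in K \<phi> T\<^esub> t = s \<oplus>\<^bsub>K\<^esub> t"
  "r \<odot>\<^bsub>module_in K \<phi> T\<^esub> t = \<phi> r \<otimes>\<^bsub>K\<^esub> t"
  by (simp_all add: module_in_def)

section \<open>Generation and regularity on rings between R and K\<close>

lemma set_smult_overring_pair: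
  assumes T: "overring T" and xy: "x \<in> carrier R" "y \<in> carrier R"
  shows "set_smult R {x, y} (module_in K \<phi> T) =
    {\<phi> x \<otimes>\<^bsub>K\<^esub> t \<oplus>\<^bsub>K\<^esub> \<phi> y \<otimes>\<^bsub>K\<^esub> t' | t t'. t \<in> T \<and> t' \<in> T}"
  using module.set_smult_pair[OF module_overring[OF T] xy] by simp

text \<open>T is a ring, so an identity 1 = x t + y t' can be multiplied by any s of T.\<close>

lemma set_smult_overring_eq_iff:
  assumes T: "overring T" and xy: "x \<in> carrier R" "y \<in> carrier R"
  shows "set_smult R {x, y} (module_in K \<phi> T) = T \<longleftrightarrow>
    \<one>\<^bsub>K\<^esub> \<in> set_smult R {x, y} (module_in K \<phi> T)"
proof
  assume "\<one>\<^bsub>K\<^esub> \<in> set_smult R {x, y} (module_in K \<phi> T)"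
  then obtain t t' where t: "t \<in> T" "t' \<in> T" "\<one>\<^bsub>K\<^esub> = \<phi> x \<otimes>\<^bsub>K\<^esub> t \<oplus>\<^bsub>K\<^esub> \<phi> y \<otimes>\<^bsub>K\<^esub> t'"
    unfolding set_smult_overring_pair[OF T xy] by blast
  have "s \<in> set_smult R {x, y} (module_in K \<phi> T)" if s: "s \<in> T" for s
  proof -
    have "s = (\<phi> x \<otimes>\<^bsub>K\<^esub> t \<oplus>\<^bsub>K\<^esub> \<phi> y \<otimes>\<^bsub>K\<^esub> t') \<otimes>\<^bsub>K\<^esub> s"
      using overring_carrier[OF T s] by (simp add: t(3)[symmetric])
    also have "\<dots> = \<phi> x \<otimes>\<^bsub>K\<^esub> (t \<otimes>\<^bsub>K\<^esub> s) \<oplus>\<^bsub>K\<^esub> \<phi> y \<otimes>\<^bsub>K\<^esub> (t' \<otimes>\<^bsub>K\<^esub> s)"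
      using overring_carrier[OF T] s t(1,2) xy by (simp add: K.l_distr K.m_assoc)
    finally show ?thesis
      unfolding set_smult_overring_pair[OF T xy] using overringD(6)[OF T] s t(1,2) by blast
  qed
  then show "set_smult R {x, y} (module_in K \<phi> T) = T"
    using module.set_smult_subset[OF module_overring[OF T], of "{x, y}"] xy by auto
qed (use overringD(4)[OF T] in simp)

lemma overring_torsion_free:
  assumes T: "overring T" and x: "x \<in> carrier R"
  shows "(\<forall>v\<in>T. \<phi> x \<otimes>\<^bsub>K\<^esub> v = \<zero>\<^bsub>K\<^esub> \<longrightarrow> v = \<zero>\<^bsub>K\<^esub>) \<longleftrightarrow> x \<noteq> \<zero>\<^bsub>R\<^esub>"
proof
  assume *: "\<forall>v\<in>T. \<phi> x \<otimes>\<^bsub>K\<^esub> v = \<zero>\<^bsub>K\<^esub> \<longrightarrow> v = \<zero>\<^bsub>K\<^esub>"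
  then have "\<phi> x \<otimes>\<^bsub>K\<^esub> \<one>\<^bsub>K\<^esub> \<noteq> \<zero>\<^bsub>K\<^esub>" using overringD(4)[OF T] by auto
  then show "x \<noteq> \<zero>\<^bsub>R\<^esub>" by auto
next
  assume "x \<noteq> \<zero>\<^bsub>R\<^esub>"
  then show "\<forall>v\<in>T. \<phi> x \<otimes>\<^bsub>K\<^esub> v = \<zero>\<^bsub>K\<^esub> \<longrightarrow> v = \<zero>\<^bsub>K\<^esub>"
    using K.integral_iff overring_carrier[OF T] phi_eq_zero_iff[OF x] x by auto
qed

lemma regular_sequence_overring_singleton:
  assumes T: "overring T"
  shows "regular_sequence R (module_in K \<phi> T) [x] \<longleftrightarrow>
    x \<in> carrier R \<and> x \<noteq> \<zero>\<^bsub>R\<^esub> \<and> \<not> (\<exists>t\<in>T. \<one>\<^bsub>K\<^esub> = \<phi> x \<otimes>\<^bsub>K\<^esub> t)"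
proof (cases "x \<in> carrier R")
  case True
  interpret M: module R "module_in K \<phi> T" by (rule module_overring[OF T])
  have "set_smult R {x} (module_in K \<phi> T) = T \<longleftrightarrow> \<one>\<^bsub>K\<^esub> \<in> set_smult R {x} (module_in K \<phi> T)"
    using set_smult_overring_eq_iff[OF T True True] by simp
  then show ?thesis
    unfolding M.regular_sequence_singleton M.set_smult_singleton[OF True]
    using overring_torsion_free[OF T True] True by auto
qed (simp add: regular_sequence_def)

text \<open>The condition on \<open>h = v / x\<close> is the one saying that \<open>y\<close> is regular modulo \<open>x\<close>.\<close>

lemma regular_sequence_overring_pair:
  assumes T: "overring T"
  shows "regular_sequence R (module_in K \<phi> T) [x, y] \<longleftrightarrow>
    x \<in> carrier R \<and> y \<in> carrier R \<and> x \<noteq> \<zero>\<^bsub>R\<^esub> \<and>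
    (\<forall>h\<in>carrier K. \<phi> x \<otimes>\<^bsub>K\<^esub> h \<in> T \<longrightarrow> \<phi> y \<otimes>\<^bsub>K\<^esub> h \<in> T \<longrightarrow> h \<in> T) \<and>
    set_smult R {x, y} (module_in K \<phi> T) \<noteq> T"
proof (cases "x \<in> carrier R \<and> y \<in> carrier R \<and> x \<noteq> \<zero>\<^bsub>R\<^esub>")
  case True
  interpret M: module R "module_in K \<phi> T" by (rule module_overring[OF T])
  have x: "x \<in> carrier R" "\<phi> x \<in> carrier K" "\<phi> x \<noteq> \<zero>\<^bsub>K\<^esub>" and y: "y \<in> carrier R" "\<phi> y \<in> carrier K"
    using True by (auto simp: phi_eq_zero_iff)
  note TK = overring_carrier[OF T]
  have "(\<forall>v\<in>T. \<forall>w\<in>T. \<phi> y \<otimes>\<^bsub>K\<^esub> v = \<phi> x \<otimes>\<^bsub>K\<^esub> w \<longrightarrow> (\<exists>w'\<in>T. v = \<phi> x \<otimes>\<^bsub>K\<^esub> w')) \<longleftrightarrow>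
      (\<forall>h\<in>carrier K. \<phi> x \<otimes>\<^bsub>K\<^esub> h \<in> T \<longrightarrow> \<phi> y \<otimes>\<^bsub>K\<^esub> h \<in> T \<longrightarrow> h \<in> T)" (is "?L \<longleftrightarrow> ?R")
  proof
    assume L: ?L
    show ?R
    proof (intro ballI impI)
      fix h assume h: "h \<in> carrier K" "\<phi> x \<otimes>\<^bsub>K\<^esub> h \<in> T" "\<phi> y \<otimes>\<^bsub>K\<^esub> h \<in> T"
      have "\<phi> y \<otimes>\<^bsub>K\<^esub> (\<phi> x \<otimes>\<^bsub>K\<^esub> h) = \<phi> x \<otimes>\<^bsub>K\<^esub> (\<phi> y \<otimes>\<^bsub>K\<^esub> h)"
        using x y h(1) by (simp add: K.m_lcomm)
      with L h obtain w where w: "w \<in> T" "\<phi> x \<otimes>\<^bsub>K\<^esub> h = \<phi> x \<otimes>\<^bsub>K\<^esub> w" by blast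
      then show "h \<in> T" using K.m_lcancel[OF x(3,2) h(1) TK[OF w(1)]] by simp
    qed
  next
    assume R: ?R
    show ?L
    proof (intro ballI impI)
      fix v w assume vw: "v \<in> T" "w \<in> T" "\<phi> y \<otimes>\<^bsub>K\<^esub> v = \<phi> x \<otimes>\<^bsub>K\<^esub> w"
      define h where "h = v \<otimes>\<^bsub>K\<^esub> inv\<^bsub>K\<^esub> \<phi> x"
      have h: "h \<in> carrier K" "\<phi> x \<otimes>\<^bsub>K\<^esub> h = v"
        using K_inv[OF x(2,3)] K_div_cancel[OF x(2,3)] TK[OF vw(1)] by (auto simp: h_def)
      have "\<phi> x \<otimes>\<^bsub>K\<^esub> (\<phi> y \<otimes>\<^bsub>K\<^esub> h) = \<phi> y \<otimes>\<^bsub>K\<^esub> (\<phi> x \<otimes>\<^bsub>K\<^esub> h)"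
        using x y h(1) by (simp add: K.m_lcomm)
      then have "\<phi> x \<otimes>\<^bsub>K\<^esub> (\<phi> y \<otimes>\<^bsub>K\<^esub> h) = \<phi> x \<otimes>\<^bsub>K\<^esub> w" using h(2) vw(3) by simp
      then have "\<phi> y \<otimes>\<^bsub>K\<^esub> h = w" using K.m_lcancel[OF x(3,2), of "\<phi> y \<otimes>\<^bsub>K\<^esub> h" w] TK[OF vw(2)] y h(1) by simp
      then have "h \<in> T" using R h vw(1,2) by simp
      then show "\<exists>w'\<in>T. v = \<phi> x \<otimes>\<^bsub>K\<^esub> w'" using h(2) by blast
    qed
  qed
  then show ?thesis
    unfolding M.regular_sequence_pair using overring_torsion_free[OF T x(1)] True by simp
next
  case False
  interpret M: module R "module_in K \<phi> T" by (rule module_overring[OF T])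
  have "\<not> regular_sequence R (module_in K \<phi> T) [x, y]"
    unfolding M.regular_sequence_pair using overring_torsion_free[OF T, of x] False by auto
  then show ?thesis using False by blast
qed

text \<open>Induction on p + q. The element a h needs one power of a less and b h one power of b
  less, so both are in T by induction, and \<open>step\<close> gives h. If p or q is 0, then h
  itself is assumed to be in T.\<close>

lemma mem_if_pow_mult_mem:
  assumes T: "overring T" and ab: "a \<in> carrier R" "b \<in> carrier R"
    and step: "\<And>h. h \<in> carrier K \<Longrightarrow> \<phi> a \<otimes>\<^bsub>K\<^esub> h \<in> T \<Longrightarrow> \<phi> b \<otimes>\<^bsub>K\<^esub> h \<in> T \<Longrightarrow> h \<in> T"
    and h: "h \<in> carrier K"
    and p: "\<phi> (a [^]\<^bsub>R\<^esub> (p::nat)) \<otimes>\<^bsub>K\<^esub> h \<in> T" and q: "\<phi> (b [^]\<^bsub>R\<^esub> (q::nat)) \<otimes>\<^bsub>K\<^esub> h \<in> T"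
  shows "h \<in> T"
  using h p q
proof (induction "p + q" arbitrary: p q h rule: less_induct)
  case less
  consider "p = 0" | "q = 0" | p' q' where "p = Suc p'" "q = Suc q'" by (cases p; cases q) auto
  then show ?case
  proof cases
    case 3
    have "\<phi> a \<otimes>\<^bsub>K\<^esub> h \<in> T"
    proof (rule less(1)[of p' q])
      show "\<phi> (a [^]\<^bsub>R\<^esub> p') \<otimes>\<^bsub>K\<^esub> (\<phi> a \<otimes>\<^bsub>K\<^esub> h) \<in> T"
        using less(2,3) 3(1) ab by (simp add: K.m_assoc)
      have "\<phi> (b [^]\<^bsub>R\<^esub> q) \<otimes>\<^bsub>K\<^esub> (\<phi> a \<otimes>\<^bsub>K\<^esub> h) = \<phi> a \<otimes>\<^bsub>K\<^esub> (\<phi> (b [^]\<^bsub>R\<^esub> q) \<otimes>\<^bsub>K\<^esub> h)"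
        using less(2) ab by (simp add: K.m_lcomm del: hom.hom_pow)
      also have "\<dots> \<in> T" using overringD(2,6)[OF T] ab(1) less(4) by blast
      finally show "\<phi> (b [^]\<^bsub>R\<^esub> q) \<otimes>\<^bsub>K\<^esub> (\<phi> a \<otimes>\<^bsub>K\<^esub> h) \<in> T" .
    qed (use 3 less(2) ab in auto)
    moreover have "\<phi> b \<otimes>\<^bsub>K\<^esub> h \<in> T"
    proof (rule less(1)[of p q'])
      show "\<phi> (b [^]\<^bsub>R\<^esub> q') \<otimes>\<^bsub>K\<^esub> (\<phi> b \<otimes>\<^bsub>K\<^esub> h) \<in> T"
        using less(2,4) 3(2) ab by (simp add: K.m_assoc)
      have "\<phi> (a [^]\<^bsub>R\<^esub> p) \<otimes>\<^bsub>K\<^esub> (\<phi> b \<otimes>\<^bsub>K\<^esub> h) = \<phi> b \<otimes>\<^bsub>K\<^esub> (\<phi> (a [^]\<^bsub>R\<^esub> p) \<otimes>\<^bsub>K\<^esub> h)"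
        using less(2) ab by (simp add: K.m_lcomm del: hom.hom_pow)
      also have "\<dots> \<in> T" using overringD(2,6)[OF T] ab(2) less(3) by blast
      finally show "\<phi> (a [^]\<^bsub>R\<^esub> p) \<otimes>\<^bsub>K\<^esub> (\<phi> b \<otimes>\<^bsub>K\<^esub> h) \<in> T" .
    qed (use 3 less(2) ab in auto)
    ultimately show ?thesis using step less(2) by blast
  qed (use less in auto)
qed

section \<open>Localization inside the fraction field\<close>

context
  fixes P assumes P: "primeideal P R"
begin

lemma compl_prime:
  shows "\<one>\<^bsub>R\<^esub> \<in> carrier R - P"
    and "s \<in> carrier R - P \<Longrightarrow> t \<in> carrier R - P \<Longrightarrow> s \<otimes>\<^bsub>R\<^esub> t \<in> carrier R - P"
    and "s \<in> carrier R - P \<Longrightarrow> s [^]\<^bsub>R\<^esub> (n::nat) \<in> carrier R - P"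
    and "s \<in> carrier R - P \<Longrightarrow> \<phi> s \<in> carrier K \<and> \<phi> s \<noteq> \<zero>\<^bsub>K\<^esub>"
proof -
  interpret P: primeideal P R by (rule P)
  show "\<one>\<^bsub>R\<^esub> \<in> carrier R - P" using primeideal_one_notin[OF P] by simp
  show "s \<in> carrier R - P \<Longrightarrow> t \<in> carrier R - P \<Longrightarrow> s \<otimes>\<^bsub>R\<^esub> t \<in> carrier R - P"
    using P.I_prime by blast
  show "s \<in> carrier R - P \<Longrightarrow> s [^]\<^bsub>R\<^esub> (n::nat) \<in> carrier R - P"
    using primeideal_pow_mem[OF P] by blast
  show "s \<in> carrier R - P \<Longrightarrow> \<phi> s \<in> carrier K \<and> \<phi> s \<noteq> \<zero>\<^bsub>K\<^esub>"
    using P.zero_closed by (auto simp: phi_eq_zero_iff)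
qed

text \<open>Division by s is replaced by multiplication: z is in T_P when some s outside P carries
  it into T. This form avoids inverses in most later computations.\<close>

lemma mem_localize_iff:
  assumes "T \<subseteq> carrier K"
  shows "z \<in> localize_in R K \<phi> P T \<longleftrightarrow>
    z \<in> carrier K \<and> (\<exists>s\<in>carrier R - P. \<phi> s \<otimes>\<^bsub>K\<^esub> z \<in> T)"
proof
  assume "z \<in> localize_in R K \<phi> P T"
  then obtain t s where ts: "t \<in> T" "s \<in> carrier R - P" "z = t \<otimes>\<^bsub>K\<^esub> inv\<^bsub>K\<^esub> \<phi> s"
    by (auto simp: localize_in_def)
  with assms have "z \<in> carrier K" "\<phi> s \<otimes>\<^bsub>K\<^esub> z \<in> T"
    using K_inv[of "\<phi> s"] K_div_cancel[of "\<phi> s" t] compl_prime(4)[of s] by auto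
  with ts(2) show "z \<in> carrier K \<and> (\<exists>s\<in>carrier R - P. \<phi> s \<otimes>\<^bsub>K\<^esub> z \<in> T)" by blast
next
  assume "z \<in> carrier K \<and> (\<exists>s\<in>carrier R - P. \<phi> s \<otimes>\<^bsub>K\<^esub> z \<in> T)"
  then obtain s where z: "z \<in> carrier K" "s \<in> carrier R - P" "\<phi> s \<otimes>\<^bsub>K\<^esub> z \<in> T" by blast
  have "z = (\<phi> s \<otimes>\<^bsub>K\<^esub> z) \<otimes>\<^bsub>K\<^esub> inv\<^bsub>K\<^esub> \<phi> s"
    using z(1) compl_prime(4)[OF z(2)] K_inv[of "\<phi> s"]
    by (metis K.m_assoc K.m_comm K.r_one)
  with z show "z \<in> localize_in R K \<phi> P T" unfolding localize_in_def by blast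
qed

lemma localize_overring:
  assumes T: "overring T"
  shows "overring (localize_in R K \<phi> P T)" "T \<subseteq> localize_in R K \<phi> P T"
proof -
  note TK = overring_carrier[OF T] and mem = mem_localize_iff[OF overringD(1)[OF T]]
  note TD = overringD(2-7)[OF T]
  show sub: "T \<subseteq> localize_in R K \<phi> P T"
    using compl_prime(1) TK by (auto simp: mem intro!: bexI[of _ "\<one>\<^bsub>R\<^esub>"])
  have "subring (localize_in R K \<phi> P T) K"
  proof (rule K.subringI)
    show "localize_in R K \<phi> P T \<subseteq> carrier K" by (auto simp: mem)
    show "\<one>\<^bsub>K\<^esub> \<in> localize_in R K \<phi> P T" using sub TD(3) by blast
    show "\<ominus>\<^bsub>K\<^esub> h \<in> localize_in R K \<phi> P T" if h: "h \<in> localize_in R K \<phi> P T" for h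
      using h TD(4) by (auto simp: mem K.r_minus)
    fix h h' assume hh': "h \<in> localize_in R K \<phi> P T" "h' \<in> localize_in R K \<phi> P T"
    then obtain s s' where h: "h \<in> carrier K" "h' \<in> carrier K" "\<phi> s \<otimes>\<^bsub>K\<^esub> h \<in> T" "\<phi> s' \<otimes>\<^bsub>K\<^esub> h' \<in> T"
      and s: "s \<in> carrier R - P" "s' \<in> carrier R - P"
      unfolding mem by blast
    have c: "\<phi> s \<in> carrier K" "\<phi> s' \<in> carrier K" "s \<in> carrier R" "s' \<in> carrier R"
      and cT: "\<phi> s \<in> T" "\<phi> s' \<in> T" using s TD(1) by auto
    have "\<phi> (s \<otimes>\<^bsub>R\<^esub> s') \<otimes>\<^bsub>K\<^esub> (h \<otimes>\<^bsub>K\<^esub> h') = (\<phi> s \<otimes>\<^bsub>K\<^esub> h) \<otimes>\<^bsub>K\<^esub> (\<phi> s' \<otimes>\<^bsub>K\<^esub> h')"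
      using c h by (simp add: K.m_ac)
    also have "\<dots> \<in> T" using TD(5) h by blast
    finally show "h \<otimes>\<^bsub>K\<^esub> h' \<in> localize_in R K \<phi> P T"
      unfolding mem using compl_prime(2)[OF s] h(1,2) by blast
    have "\<phi> (s \<otimes>\<^bsub>R\<^esub> s') \<otimes>\<^bsub>K\<^esub> (h \<oplus>\<^bsub>K\<^esub> h') =
        \<phi> s' \<otimes>\<^bsub>K\<^esub> (\<phi> s \<otimes>\<^bsub>K\<^esub> h) \<oplus>\<^bsub>K\<^esub> \<phi> s \<otimes>\<^bsub>K\<^esub> (\<phi> s' \<otimes>\<^bsub>K\<^esub> h')"
      using c h(1,2) by (simp add: K.r_distr K.m_ac)
    also have "\<dots> \<in> T" using TD(5,6) cT h by blast
    finally show "h \<oplus>\<^bsub>K\<^esub> h' \<in> localize_in R K \<phi> P T"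
      unfolding mem using compl_prime(2)[OF s] h(1,2) by blast
  qed
  then show "overring (localize_in R K \<phi> P T)"
    using sub TD(1) by (auto simp: overring_def)
qed

text \<open>K is also the fraction field of R_P, since numerators and denominators from R suffice.
  All facts of the locale thereby become available over R_P, with the identity as embedding.\<close>

lemma frac_field_localize:
  "frac_field (K\<lparr>carrier := localize_in R K \<phi> P (\<phi> ` carrier R)\<rparr>) K (\<lambda>x. x)"
proof
  let ?A = "localize_in R K \<phi> P (\<phi> ` carrier R)"
  note ov = localize_overring(1)[OF overring_phi_image]
  have sub: "subring ?A K" using ov by (simp add: overring_def)
  have "domain (K\<lparr>carrier := ?A\<rparr>)" by (rule K.subring_is_domain[OF sub])
  moreover have "\<exists>a\<in>?A. \<exists>b\<in>?A - {\<zero>\<^bsub>K\<^esub>}. z = a \<otimes>\<^bsub>K\<^esub> inv\<^bsub>K\<^esub> b" if z: "z \<in> carrier K" for z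
  proof -
    obtain a b where ab: "a \<in> carrier R" "b \<in> carrier R - {\<zero>\<^bsub>R\<^esub>}"
        and eq: "z = \<phi> a \<otimes>\<^bsub>K\<^esub> inv\<^bsub>K\<^esub> \<phi> b"
      using fraction_field z unfolding fraction_field_def by meson
    have "\<phi> a \<in> ?A" "\<phi> b \<in> ?A - {\<zero>\<^bsub>K\<^esub>}"
      using ab overringD(2)[OF ov] by (auto simp: phi_eq_zero_iff)
    with eq show ?thesis by blast
  qed
  ultimately show "fraction_field (K\<lparr>carrier := ?A\<rparr>) K (\<lambda>x. x)"
    using overringD(1)[OF ov] K.field_axioms
    by (auto simp: fraction_field_def ring_hom_def)
qed

end

text \<open>Here T_P is viewed over R_P instead of R, as the depth condition at P demands.\<close>

lemma overring_localize:
  assumes P: "primeideal P R" and T: "overring T"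
  shows "frac_field.overring (K\<lparr>carrier := localize_in R K \<phi> P (\<phi> ` carrier R)\<rparr>) K (\<lambda>x. x)
    (localize_in R K \<phi> P T)"
proof -
  interpret A: frac_field "K\<lparr>carrier := localize_in R K \<phi> P (\<phi> ` carrier R)\<rparr>" K "\<lambda>x. x"
    by (rule frac_field_localize[OF P])
  have "localize_in R K \<phi> P (\<phi> ` carrier R) \<subseteq> localize_in R K \<phi> P T"
    using overringD(2)[OF T] unfolding localize_in_def by blast
  then show ?thesis
    using localize_overring(1)[OF P T] by (simp add: A.overring_def overring_def)
qed

end

section \<open>Local domains of dimension two\<close>

locale local_domain_dim2 = frac_field +
  assumes local_ring: "local_ring R" and dim: "krull_dim R = 2"
begin

lemma dim_eq: "krull_dim R = enat 2"
  using dim by (simp add: numeral_eq_enat)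

lemma primeideal_max: "primeideal (max_ideal R) R"
  by (rule max_ideal_primeideal[OF local_ring])

lemma max_ideal_carrier: "c \<in> max_ideal R \<Longrightarrow> c \<in> carrier R"
  using primeideal_max by (auto simp: primeideal_def dest: ideal.Icarr)

text \<open>Elements outside m are units of R, so division by them does not leave a set that is
  stable under R. Such sets include the image of m in K as well as the overrings.\<close>

lemma localize_max_ideal:
  assumes T: "T \<subseteq> carrier K" "\<And>r t. r \<in> carrier R \<Longrightarrow> t \<in> T \<Longrightarrow> \<phi> r \<otimes>\<^bsub>K\<^esub> t \<in> T"
  shows "localize_in R K \<phi> (max_ideal R) T = T"
proof -
  have "z \<in> T" if z: "z \<in> carrier K" "s \<in> carrier R - max_ideal R" "\<phi> s \<otimes>\<^bsub>K\<^esub> z \<in> T" for z s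
  proof -
    obtain y where y: "y \<in> carrier R" "s \<otimes>\<^bsub>R\<^esub> y = \<one>\<^bsub>R\<^esub>"
      using unit_if_notin_max_ideal[OF local_ring] z(2) by auto
    have s: "s \<in> carrier R" using z(2) by simp
    have "\<phi> y \<otimes>\<^bsub>K\<^esub> (\<phi> s \<otimes>\<^bsub>K\<^esub> z) = \<phi> (s \<otimes>\<^bsub>R\<^esub> y) \<otimes>\<^bsub>K\<^esub> z"
      using z(1) y(1) s by (simp add: K.m_ac)
    then have "\<phi> y \<otimes>\<^bsub>K\<^esub> (\<phi> s \<otimes>\<^bsub>K\<^esub> z) = z" using y(2) z(1) by simp
    then show ?thesis using T(2)[OF y(1) z(3)] by simp
  qed
  moreover have "z \<in> localize_in R K \<phi> (max_ideal R) T" if z: "z \<in> T" for z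
    unfolding mem_localize_iff[OF primeideal_max T(1)]
    using z T(1) compl_prime(1)[OF primeideal_max] by (auto intro!: bexI[of _ "\<one>\<^bsub>R\<^esub>"])
  ultimately show ?thesis
    using mem_localize_iff[OF primeideal_max T(1)] by (intro equalityI subsetI) blast+
qed

lemma localize_max_ideal_overring: "overring T \<Longrightarrow> localize_in R K \<phi> (max_ideal R) T = T"
  using overringD(1,2,6) by (intro localize_max_ideal) auto

lemma localize_max_ideal_image: "localize_in R K \<phi> (max_ideal R) (\<phi> ` max_ideal R) = \<phi> ` max_ideal R"
proof (rule localize_max_ideal)
  interpret m: primeideal "max_ideal R" R by (rule primeideal_max)
  show "\<phi> ` max_ideal R \<subseteq> carrier K" using max_ideal_carrier by auto
  fix r t assume r: "r \<in> carrier R" and "t \<in> \<phi> ` max_ideal R"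
  then obtain c where c: "c \<in> max_ideal R" "t = \<phi> c" by blast
  then have "\<phi> r \<otimes>\<^bsub>K\<^esub> t = \<phi> (r \<otimes>\<^bsub>R\<^esub> c)" using r by simp
  then show "\<phi> r \<otimes>\<^bsub>K\<^esub> t \<in> \<phi> ` max_ideal R" using m.I_l_closed[OF c(1) r] by blast
qed

text \<open>At m the depth condition refers to the image of R in K. Since \<open>\<phi>\<close> is
  injective, both sides unfold to the same condition on elements of K.\<close>

lemma regular_sequence_base_change:
  assumes T: "overring T" and ab: "a \<in> carrier R" "b \<in> carrier R"
  shows "regular_sequence (K\<lparr>carrier := \<phi> ` carrier R\<rparr>) (module_in K (\<lambda>x. x) T) [\<phi> a, \<phi> b] \<longleftrightarrow>
    regular_sequence R (module_in K \<phi> T) [a, b]"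
proof -
  interpret A: frac_field "K\<lparr>carrier := \<phi> ` carrier R\<rparr>" K "\<lambda>x. x"
    using frac_field_localize[OF primeideal_max] localize_max_ideal_overring[OF overring_phi_image] by simp
  have AT: "A.overring T" using T by (simp add: A.overring_def overring_def)
  have "set_smult (K\<lparr>carrier := \<phi> ` carrier R\<rparr>) {\<phi> a, \<phi> b} (module_in K (\<lambda>x. x) T) =
      set_smult R {a, b} (module_in K \<phi> T)"
    using A.set_smult_overring_pair[OF AT] set_smult_overring_pair[OF T ab] ab by simp
  then show ?thesis
    unfolding A.regular_sequence_overring_pair[OF AT] regular_sequence_overring_pair[OF T]
    using ab by (simp add: phi_eq_zero_iff)
qed

text \<open>The height of m is at least 2, so the minimum in the depth condition at m equals
  2.\<close>

lemma S2_extension_regular_pair: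
  assumes "S2_extension R K \<phi> T"
  obtains a b where "a \<in> max_ideal R" "b \<in> max_ideal R" "regular_sequence R (module_in K \<phi> T) [a, b]"
proof -
  let ?A = "K\<lparr>carrier := \<phi> ` carrier R\<rparr>"
  have T: "overring T" using assms by (simp add: S2_extension_def overring_def)
  interpret A: frac_field ?A K "\<lambda>x. x"
    using frac_field_localize[OF primeideal_max] localize_max_ideal_overring[OF overring_phi_image] by simp
  have AT: "A.overring T" using T by (simp add: A.overring_def overring_def)
  have "min (enat 2) (height R (max_ideal R)) \<le> depth ?A (\<phi> ` max_ideal R) (module_in K (\<lambda>x. x) T)"
    using assms primeideal_max localize_max_ideal_overring[OF T] localize_max_ideal_image
      localize_max_ideal_overring[OF overring_phi_image]
    by (auto simp: S2_extension_def serre_condition_def)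
  moreover have "enat 2 \<le> height R (max_ideal R)"
    using height_max_ideal[OF local_ring dim_eq] dim_eq by simp
  ultimately have depth: "enat 2 \<le> depth ?A (\<phi> ` max_ideal R) (module_in K (\<lambda>x. x) T)"
    by (simp add: min_def)
  obtain xs where xs: "length xs = 2" "set xs \<subseteq> \<phi> ` max_ideal R"
      "regular_sequence ?A (module_in K (\<lambda>x. x) T) xs"
    using depth_ge_regular_sequence[OF A.module_overring[OF AT] depth] by auto
  obtain x y where "xs = [x, y]" using xs(1) by (auto simp: numeral_2_eq_2 length_Suc_conv)
  moreover from this obtain a b where ab: "a \<in> max_ideal R" "b \<in> max_ideal R" "x = \<phi> a" "y = \<phi> b"
    using xs(2) by auto
  ultimately show thesis
    using that[OF ab(1,2)] regular_sequence_base_change[OF T] xs(3) ab max_ideal_carrier by simp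
qed

text \<open>A prime containing \<open>a\<close>, avoiding the powers of \<open>b\<close> and contained in \<open>P\<close> would sit strictly
  between \<open>0\<close> and \<open>P\<close>.\<close>

lemma prime_element_relation:
  assumes P: "primeideal P R" "P \<noteq> max_ideal R" and a: "a \<in> P" "a \<noteq> \<zero>\<^bsub>R\<^esub>" and b: "b \<in> P"
  obtains n s r where "s \<in> carrier R - P" "r \<in> carrier R" "b [^]\<^bsub>R\<^esub> (n::nat) \<otimes>\<^bsub>R\<^esub> s = a \<otimes>\<^bsub>R\<^esub> r"
proof (rule ccontr)
  assume no: "\<not> thesis"
  interpret P: primeideal P R by (rule P(1))
  have ab: "a \<in> carrier R" "b \<in> carrier R" using a(1) b by auto
  note cP = compl_prime(1,2)[OF P(1)]
  \<comment> \<open>A prime Q disjoint from this set lies inside P, by the elements with n = 0, and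
    omits b, by the element with n = 1 and s = 1.\<close>
  let ?W = "{b [^]\<^bsub>R\<^esub> (n::nat) \<otimes>\<^bsub>R\<^esub> s | n s. s \<in> carrier R - P}"
  have W0: "PIdl\<^bsub>R\<^esub> a \<inter> ?W = {}"
  proof (rule ccontr)
    assume "PIdl\<^bsub>R\<^esub> a \<inter> ?W \<noteq> {}"
    then obtain z where "z \<in> PIdl\<^bsub>R\<^esub> a" "z \<in> ?W" by blast
    then obtain r n s where "r \<in> carrier R" "z = r \<otimes>\<^bsub>R\<^esub> a" "s \<in> carrier R - P" "z = b [^]\<^bsub>R\<^esub> (n::nat) \<otimes>\<^bsub>R\<^esub> s"
      unfolding cgenideal_def by blast
    then have "b [^]\<^bsub>R\<^esub> n \<otimes>\<^bsub>R\<^esub> s = a \<otimes>\<^bsub>R\<^esub> r" using ab R.m_comm by metis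
    then show False using no that \<open>s \<in> carrier R - P\<close> \<open>r \<in> carrier R\<close> by blast
  qed
  have W1: "?W \<subseteq> carrier R" using ab by auto
  have W2: "\<one>\<^bsub>R\<^esub> \<in> ?W"
    using cP(1) by (intro CollectI exI[of _ "0::nat"] exI[of _ "\<one>\<^bsub>R\<^esub>"]) simp
  have W3: "v \<otimes>\<^bsub>R\<^esub> w \<in> ?W" if vw: "v \<in> ?W" "w \<in> ?W" for v w
  proof -
    obtain n s n' s' where 1: "s \<in> carrier R - P" "v = b [^]\<^bsub>R\<^esub> (n::nat) \<otimes>\<^bsub>R\<^esub> s"
        "s' \<in> carrier R - P" "w = b [^]\<^bsub>R\<^esub> (n'::nat) \<otimes>\<^bsub>R\<^esub> s'"
      using vw by blast
    have "v \<otimes>\<^bsub>R\<^esub> w = b [^]\<^bsub>R\<^esub> (n + n') \<otimes>\<^bsub>R\<^esub> (s \<otimes>\<^bsub>R\<^esub> s')"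
      using 1 ab by (simp add: R.nat_pow_mult[symmetric] R.m_ac)
    then show ?thesis using cP(2)[OF 1(1,3)] by blast
  qed
  obtain Q where Q: "primeideal Q R" "PIdl\<^bsub>R\<^esub> a \<subseteq> Q" "Q \<inter> ?W = {}"
    by (rule R.exists_prime_avoiding[OF R.cgenideal_ideal[OF ab(1)] W0 W1 W2 W3])
  interpret Q: primeideal Q R by (rule Q(1))
  have "s \<in> ?W" if "s \<in> carrier R - P" for s
    using that by (intro CollectI exI[of _ "0::nat"] exI[of _ s]) simp
  then have "Q \<subseteq> P" using Q(3) Q.a_subset by blast
  moreover have "b \<in> ?W"
    using cP(1) ab by (intro CollectI exI[of _ "1::nat"] exI[of _ "\<one>\<^bsub>R\<^esub>"]) simp
  then have "b \<notin> Q" using Q(3) by blast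
  ultimately have "Q \<subset> P" using b by blast
  moreover have "a \<in> Q" using Q(2) R.cgenideal_self[OF ab(1)] by blast
  then have "Q \<noteq> {\<zero>\<^bsub>R\<^esub>}" using a(2) by blast
  moreover have "P \<subset> max_ideal R" using prime_subset_max_ideal[OF local_ring P(1)] P(2) by blast
  ultimately show False
    using prime_chain_four[OF dim R.domain_axioms Q(1) P(1) primeideal_max] by blast
qed

text \<open>The radical of (a, b) is the intersection of the primes above it, so it equals m exactly
  when no smaller prime contains both a and b.\<close>

lemma system_of_parameters_pair_iff:
  "system_of_parameters R [a, b] \<longleftrightarrow> a \<in> max_ideal R \<and> b \<in> max_ideal R \<and>
    (\<forall>P. primeideal P R \<longrightarrow> a \<in> P \<longrightarrow> b \<in> P \<longrightarrow> max_ideal R \<subseteq> P)"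
proof (cases "a \<in> max_ideal R \<and> b \<in> max_ideal R")
  case True
  interpret m: primeideal "max_ideal R" R by (rule primeideal_max)
  have ab: "{a, b} \<subseteq> carrier R" using True by auto
  let ?I = "Idl\<^bsub>R\<^esub> {a, b}"
  have I: "ideal ?I R" by (rule R.genideal_ideal[OF ab])
  have "radical R ?I \<subseteq> max_ideal R"
    using R.genideal_minimal[OF m.is_ideal, of "{a, b}"] True primeideal_pow_mem[OF primeideal_max]
    by (auto simp: radical_def)
  moreover have "max_ideal R \<subseteq> radical R ?I \<longleftrightarrow>
      (\<forall>P. primeideal P R \<longrightarrow> a \<in> P \<longrightarrow> b \<in> P \<longrightarrow> max_ideal R \<subseteq> P)"
  proof
    assume rad: "max_ideal R \<subseteq> radical R ?I"
    show "\<forall>P. primeideal P R \<longrightarrow> a \<in> P \<longrightarrow> b \<in> P \<longrightarrow> max_ideal R \<subseteq> P"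
    proof (intro allI impI subsetI)
      fix P c assume P: "primeideal P R" "a \<in> P" "b \<in> P" "c \<in> max_ideal R"
      have "?I \<subseteq> P" using R.genideal_minimal[of P "{a, b}"] P by (auto simp: primeideal_def)
      moreover obtain n where "c [^]\<^bsub>R\<^esub> (n::nat) \<in> ?I"
        using subsetD[OF rad P(4)] by (auto simp: radical_def)
      ultimately show "c \<in> P"
        using primeideal_pow_mem[OF P(1) max_ideal_carrier[OF P(4)], of n] by blast
    qed
  next
    assume P: "\<forall>P. primeideal P R \<longrightarrow> a \<in> P \<longrightarrow> b \<in> P \<longrightarrow> max_ideal R \<subseteq> P"
    show "max_ideal R \<subseteq> radical R ?I"
    proof
      fix c assume c: "c \<in> max_ideal R"
      show "c \<in> radical R ?I"
        by (rule radical_memI[OF R.is_cring I max_ideal_carrier[OF c]])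
          (use P c R.genideal_self[OF ab] in blast)
    qed
  qed
  ultimately show ?thesis using True dim_eq by (auto simp: system_of_parameters_def)
qed (auto simp: system_of_parameters_def)

text \<open>A prime containing a power of a contains a. The exponents are successors because a
  zeroth power is 1 and does not lie in m.\<close>

lemma system_of_parameters_pow:
  assumes "system_of_parameters R [a, b]"
  shows "system_of_parameters R [a [^]\<^bsub>R\<^esub> Suc n, b [^]\<^bsub>R\<^esub> Suc k]"
proof -
  interpret m: primeideal "max_ideal R" R by (rule primeideal_max)
  have ab: "a \<in> max_ideal R" "b \<in> max_ideal R" "a \<in> carrier R" "b \<in> carrier R"
    using assms by (auto simp: system_of_parameters_pair_iff)
  have "max_ideal R \<subseteq> P"
    if P: "primeideal P R" "a [^]\<^bsub>R\<^esub> Suc n \<in> P" "b [^]\<^bsub>R\<^esub> Suc k \<in> P" for P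
    using assms P primeideal_pow_mem[OF P(1) ab(3) P(2)] primeideal_pow_mem[OF P(1) ab(4) P(3)]
    by (simp add: system_of_parameters_pair_iff del: nat_pow_Suc)
  moreover have "a [^]\<^bsub>R\<^esub> Suc n \<in> max_ideal R" "b [^]\<^bsub>R\<^esub> Suc k \<in> max_ideal R"
    using m.I_l_closed[OF ab(1), of "a [^]\<^bsub>R\<^esub> n"] m.I_l_closed[OF ab(2), of "b [^]\<^bsub>R\<^esub> k"] ab(3,4)
    by simp_all
  ultimately show ?thesis unfolding system_of_parameters_pair_iff by blast
qed

text \<open>Comparing (x, y) with the sum of two principal ideals turns membership of c in the
  radical into an explicit identity.\<close>

lemma system_of_parameters_pow_combination:
  assumes xy: "system_of_parameters R [x, y]" and c: "c \<in> max_ideal R"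
  obtains n r s where "r \<in> carrier R" "s \<in> carrier R"
    "c [^]\<^bsub>R\<^esub> (n::nat) = x \<otimes>\<^bsub>R\<^esub> r \<oplus>\<^bsub>R\<^esub> y \<otimes>\<^bsub>R\<^esub> s"
proof -
  have x: "x \<in> carrier R" and y: "y \<in> carrier R"
    using xy max_ideal_carrier by (auto simp: system_of_parameters_pair_iff)
  let ?J = "set_add R (PIdl\<^bsub>R\<^esub> x) (PIdl\<^bsub>R\<^esub> y)"
  have J: "ideal ?J R" by (rule R.add_ideals[OF R.cgenideal_ideal[OF x] R.cgenideal_ideal[OF y]])
  have mem: "z \<in> ?J \<longleftrightarrow> (\<exists>r\<in>carrier R. \<exists>s\<in>carrier R. z = r \<otimes>\<^bsub>R\<^esub> x \<oplus>\<^bsub>R\<^esub> s \<otimes>\<^bsub>R\<^esub> y)" for z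
    by (auto simp: set_add_def' cgenideal_def)
  have "x \<in> ?J" unfolding mem using x y by (intro bexI[of _ "\<one>\<^bsub>R\<^esub>"] bexI[of _ "\<zero>\<^bsub>R\<^esub>"]) auto
  moreover have "y \<in> ?J" unfolding mem using x y by (intro bexI[of _ "\<zero>\<^bsub>R\<^esub>"] bexI[of _ "\<one>\<^bsub>R\<^esub>"]) auto
  ultimately have "Idl\<^bsub>R\<^esub> {x, y} \<subseteq> ?J" by (intro R.genideal_minimal[OF J]) auto
  moreover obtain n where "c [^]\<^bsub>R\<^esub> (n::nat) \<in> Idl\<^bsub>R\<^esub> {x, y}"
    using xy c unfolding system_of_parameters_def radical_def by auto
  ultimately have "c [^]\<^bsub>R\<^esub> n \<in> ?J" by blast
  then obtain r s where "r \<in> carrier R" "s \<in> carrier R" "c [^]\<^bsub>R\<^esub> n = r \<otimes>\<^bsub>R\<^esub> x \<oplus>\<^bsub>R\<^esub> s \<otimes>\<^bsub>R\<^esub> y"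
    unfolding mem by blast
  then show thesis using that[of r s n] x y R.m_comm by simp
qed

text \<open>Invertibility of a on T_P spreads to all nonzero elements of P: a power of a, times some
  element outside P, is a multiple of any given nonzero p in P. Hence no single element of P R_P is
  regular on T_P, although the height of P is positive.\<close>

lemma S2_extension_system_of_parameters:
  assumes S2: "S2_extension R K \<phi> T" and ab: "a \<in> max_ideal R" "b \<in> max_ideal R"
    and reg: "regular_sequence R (module_in K \<phi> T) [a, b]"
  shows "system_of_parameters R [a, b]"
  unfolding system_of_parameters_pair_iff
proof (intro conjI allI impI ab)
  have T: "overring T" using S2 by (simp add: S2_extension_def overring_def)
  fix P assume P: "primeideal P R" "a \<in> P" "b \<in> P"
  have aR: "a \<in> carrier R" "a \<noteq> \<zero>\<^bsub>R\<^esub>" and bR: "b \<in> carrier R"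
    and step: "\<And>h. h \<in> carrier K \<Longrightarrow> \<phi> a \<otimes>\<^bsub>K\<^esub> h \<in> T \<Longrightarrow> \<phi> b \<otimes>\<^bsub>K\<^esub> h \<in> T \<Longrightarrow> h \<in> T"
    using reg[unfolded regular_sequence_overring_pair[OF T]] by auto
  have phia: "\<phi> a \<in> carrier K" "\<phi> a \<noteq> \<zero>\<^bsub>K\<^esub>" using aR by (auto simp: phi_eq_zero_iff)
  show "max_ideal R \<subseteq> P"
  proof (rule ccontr)
    assume "\<not> max_ideal R \<subseteq> P"
    then have Pm: "P \<noteq> max_ideal R" by blast
    interpret P: primeideal P R by (rule P(1))
    let ?A = "localize_in R K \<phi> P (\<phi> ` carrier R)" and ?TP = "localize_in R K \<phi> P T"
    interpret A: frac_field "K\<lparr>carrier := ?A\<rparr>" K "\<lambda>x. x"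
      by (rule frac_field_localize[OF P(1)])
    have AT: "A.overring ?TP" by (rule overring_localize[OF P(1) T])
    have "1 \<le> height R P" using height_ge_1[OF R.domain_axioms P(1)] P(2) aR(2) by blast
    then have "enat 1 \<le> min (enat 2) (height R P)" by (simp add: one_enat_def)
    also have "\<dots> \<le> depth (K\<lparr>carrier := ?A\<rparr>) (localize_in R K \<phi> P (\<phi> ` P)) (module_in K (\<lambda>x. x) ?TP)"
      using S2 P(1) by (simp add: S2_extension_def serre_condition_def)
    finally obtain xs where "length xs = 1" "set xs \<subseteq> localize_in R K \<phi> P (\<phi> ` P)"
        "regular_sequence (K\<lparr>carrier := ?A\<rparr>) (module_in K (\<lambda>x. x) ?TP) xs"
      using depth_ge_regular_sequence[OF A.module_overring[OF AT]] by auto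
    then obtain z where z: "z \<in> localize_in R K \<phi> P (\<phi> ` P)"
        "regular_sequence (K\<lparr>carrier := ?A\<rparr>) (module_in K (\<lambda>x. x) ?TP) [z]"
      by (auto simp: length_Suc_conv)
    then have z0: "z \<noteq> \<zero>\<^bsub>K\<^esub>" and z1: "\<And>t. t \<in> ?TP \<Longrightarrow> \<one>\<^bsub>K\<^esub> \<noteq> z \<otimes>\<^bsub>K\<^esub> t"
      unfolding A.regular_sequence_overring_singleton[OF AT] by auto
    have "\<phi> ` P \<subseteq> carrier K" by auto
    \<comment> \<open>Clearing the denominator of z: up to the factor c outside P, z is an element p
      of P.\<close>
    then obtain c p where zK: "z \<in> carrier K" and c: "c \<in> carrier R - P" and p: "p \<in> P" "\<phi> c \<otimes>\<^bsub>K\<^esub> z = \<phi> p"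
      using z(1) mem_localize_iff[OF P(1)] by blast
    have cR: "c \<in> carrier R" "\<phi> c \<in> carrier K" "\<phi> c \<noteq> \<zero>\<^bsub>K\<^esub>" and pR: "p \<in> carrier R"
      using c compl_prime(4)[OF P(1) c] p(1) by auto
    have p0: "p \<noteq> \<zero>\<^bsub>R\<^esub>" using p(2) cR z0 zK K.integral_iff by auto
    obtain n s r where s: "s \<in> carrier R - P" "r \<in> carrier R" "b [^]\<^bsub>R\<^esub> (n::nat) \<otimes>\<^bsub>R\<^esub> s = a \<otimes>\<^bsub>R\<^esub> r"
      using prime_element_relation[OF P(1) Pm P(2) aR(2) P(3)] by blast
    have sR: "s \<in> carrier R" using s(1) by simp
    \<comment> \<open>This is s / a. Both a h = s and b^n h = r come from R, so the regular pair
      forces h into T; it inverts a up to the factor s outside P.\<close>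
    define h where "h = \<phi> s \<otimes>\<^bsub>K\<^esub> inv\<^bsub>K\<^esub> \<phi> a"
    have h: "h \<in> carrier K" "\<phi> a \<otimes>\<^bsub>K\<^esub> h = \<phi> s"
      using K_inv[OF phia] K_div_cancel[OF phia, of "\<phi> s"] sR by (auto simp: h_def)
    have hT: "h \<in> T"
    proof (rule mem_if_pow_mult_mem[OF T aR(1) bR step h(1)])
      show "\<phi> (a [^]\<^bsub>R\<^esub> (1::nat)) \<otimes>\<^bsub>K\<^esub> h \<in> T" using h(2) aR(1) sR overringD(2)[OF T] by simp
      have "\<phi> a \<otimes>\<^bsub>K\<^esub> (\<phi> (b [^]\<^bsub>R\<^esub> n) \<otimes>\<^bsub>K\<^esub> h) = \<phi> (b [^]\<^bsub>R\<^esub> n) \<otimes>\<^bsub>K\<^esub> \<phi> s"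
        using K.m_lcomm[of "\<phi> a" "\<phi> (b [^]\<^bsub>R\<^esub> n)" h] phia h bR by (simp del: hom.hom_pow)
      also have "\<dots> = \<phi> (a \<otimes>\<^bsub>R\<^esub> r)" using bR sR by (simp add: s(3)[symmetric])
      also have "\<dots> = \<phi> a \<otimes>\<^bsub>K\<^esub> \<phi> r" using aR s(2) by simp
      finally have "\<phi> (b [^]\<^bsub>R\<^esub> n) \<otimes>\<^bsub>K\<^esub> h = \<phi> r"
        using K.m_lcancel[OF phia(2,1)] bR h(1) s(2) by (simp del: hom.hom_pow)
      then show "\<phi> (b [^]\<^bsub>R\<^esub> n) \<otimes>\<^bsub>K\<^esub> h \<in> T" using overringD(2)[OF T] s(2) by simp
    qed
    \<comment> \<open>The same relation with p and a in the places of a and b.\<close>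
    obtain k s' r' where s': "s' \<in> carrier R - P" "r' \<in> carrier R" "a [^]\<^bsub>R\<^esub> (k::nat) \<otimes>\<^bsub>R\<^esub> s' = p \<otimes>\<^bsub>R\<^esub> r'"
      using prime_element_relation[OF P(1) Pm p(1) p0 P(2)] by blast
    have s'R: "s' \<in> carrier R" using s'(1) by simp
    define w where "w = s [^]\<^bsub>R\<^esub> k \<otimes>\<^bsub>R\<^esub> s'"
    have w: "w \<in> carrier R - P"
      unfolding w_def by (intro compl_prime(2,3)[OF P(1)] s(1) s'(1))
    have wR: "w \<in> carrier R" "\<phi> w \<in> carrier K" "\<phi> w \<noteq> \<zero>\<^bsub>K\<^esub>"
      using w compl_prime(4)[OF P(1) w] by auto
    \<comment> \<open>The factor v is chosen so that z v = p r' h^k = a^k s' h^k = s^k s' = w. As w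
      is outside P, the quotient v / w lies in T_P and inverts z there.\<close>
    define v where "v = \<phi> c \<otimes>\<^bsub>K\<^esub> (\<phi> r' \<otimes>\<^bsub>K\<^esub> h [^]\<^bsub>K\<^esub> k)"
    have "h [^]\<^bsub>K\<^esub> k \<in> T" by (induction k) (use overringD(4,6)[OF T] hT in auto)
    then have v: "v \<in> T" "v \<in> carrier K"
      unfolding v_def using overringD(2,6)[OF T] cR(1) s'(2) h(1) cR(2) by auto
    have "z \<otimes>\<^bsub>K\<^esub> v = (\<phi> c \<otimes>\<^bsub>K\<^esub> z) \<otimes>\<^bsub>K\<^esub> (\<phi> r' \<otimes>\<^bsub>K\<^esub> h [^]\<^bsub>K\<^esub> k)"
      unfolding v_def using cR zK h(1) s'(2) by (simp add: K.m_ac)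
    also have "\<dots> = \<phi> (p \<otimes>\<^bsub>R\<^esub> r') \<otimes>\<^bsub>K\<^esub> h [^]\<^bsub>K\<^esub> k"
      using p(2) pR s'(2) h(1) by (simp add: K.m_assoc)
    also have "\<dots> = \<phi> (a [^]\<^bsub>R\<^esub> k \<otimes>\<^bsub>R\<^esub> s') \<otimes>\<^bsub>K\<^esub> h [^]\<^bsub>K\<^esub> k" by (simp add: s'(3))
    also have "\<dots> = (\<phi> a [^]\<^bsub>K\<^esub> k \<otimes>\<^bsub>K\<^esub> h [^]\<^bsub>K\<^esub> k) \<otimes>\<^bsub>K\<^esub> \<phi> s'"
      using aR s'R h(1) by (simp add: K.m_ac)
    also have "\<dots> = (\<phi> a \<otimes>\<^bsub>K\<^esub> h) [^]\<^bsub>K\<^esub> k \<otimes>\<^bsub>K\<^esub> \<phi> s'"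
      using phia(1) h(1) by (simp add: K.nat_pow_distrib)
    also have "\<dots> = \<phi> w" unfolding h(2) w_def using sR s'R by simp
    finally have zv: "z \<otimes>\<^bsub>K\<^esub> v = \<phi> w" .
    define t where "t = v \<otimes>\<^bsub>K\<^esub> inv\<^bsub>K\<^esub> \<phi> w"
    have "t \<in> ?TP" unfolding t_def localize_in_def using v(1) w by blast
    moreover have "z \<otimes>\<^bsub>K\<^esub> t = (z \<otimes>\<^bsub>K\<^esub> v) \<otimes>\<^bsub>K\<^esub> inv\<^bsub>K\<^esub> \<phi> w"
      unfolding t_def using zK v(2) K_inv[OF wR(2,3)] by (simp add: K.m_assoc)
    then have "z \<otimes>\<^bsub>K\<^esub> t = \<one>\<^bsub>K\<^esub>" using K_inv[OF wR(2,3)] by (simp add: zv)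
    ultimately show False using z1[of t] by simp
  qed
qed

section \<open>Big Cohen--Macaulay modules\<close>

text \<open>Regularity only says that (a, b) T is proper. A prime Q of the ring T above (a, b) T
  contains a power of each element of m, hence m itself, and so m T stays inside Q.\<close>

lemma S2_extension_max_ideal_mult_neq:
  assumes S2: "S2_extension R K \<phi> T"
  shows "set_smult R (max_ideal R) (module_in K \<phi> T) \<noteq> T"
proof
  have T: "overring T" using S2 by (simp add: S2_extension_def overring_def)
  assume eq: "set_smult R (max_ideal R) (module_in K \<phi> T) = T"
  obtain a b where ab: "a \<in> max_ideal R" "b \<in> max_ideal R" "regular_sequence R (module_in K \<phi> T) [a, b]"
    using S2_extension_regular_pair[OF S2] by blast
  have sop: "system_of_parameters R [a, b]" by (rule S2_extension_system_of_parameters[OF S2 ab])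
  have abR: "a \<in> carrier R" "b \<in> carrier R" using ab max_ideal_carrier by auto
  let ?J = "set_smult R {a, b} (module_in K \<phi> T)" and ?T = "K\<lparr>carrier := T\<rparr>"
  have J: "z \<in> ?J \<longleftrightarrow> (\<exists>t\<in>T. \<exists>t'\<in>T. z = \<phi> a \<otimes>\<^bsub>K\<^esub> t \<oplus>\<^bsub>K\<^esub> \<phi> b \<otimes>\<^bsub>K\<^esub> t')" for z
    unfolding set_smult_overring_pair[OF T abR] by blast
  have one: "\<one>\<^bsub>K\<^esub> \<notin> ?J"
    using ab(3) regular_sequence_overring_pair[OF T] set_smult_overring_eq_iff[OF T abR] by simp
  have subT: "subring T K" using T by (simp add: overring_def)
  interpret M: module R "module_in K \<phi> T" by (rule module_overring[OF T])
  interpret D: domain ?T by (rule K.subring_is_domain[OF subT])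
  note TK = overring_carrier[OF T] and TD = overringD(2-7)[OF T]
  have JT: "?J \<subseteq> T" using M.set_smult_subset[of "{a, b}"] abR by simp
  \<comment> \<open>By definition \<open>?J\<close> is only an R-submodule; absorption of factors
    from T makes it an ideal of T.\<close>
  have Jmult: "t \<otimes>\<^bsub>K\<^esub> z \<in> ?J" if tz: "t \<in> T" "z \<in> ?J" for t z
  proof -
    obtain u u' where u: "u \<in> T" "u' \<in> T" "z = \<phi> a \<otimes>\<^bsub>K\<^esub> u \<oplus>\<^bsub>K\<^esub> \<phi> b \<otimes>\<^bsub>K\<^esub> u'"
      using tz(2) unfolding J by blast
    have "t \<otimes>\<^bsub>K\<^esub> z = \<phi> a \<otimes>\<^bsub>K\<^esub> (t \<otimes>\<^bsub>K\<^esub> u) \<oplus>\<^bsub>K\<^esub> \<phi> b \<otimes>\<^bsub>K\<^esub> (t \<otimes>\<^bsub>K\<^esub> u')"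
      unfolding u(3) using TK u(1,2) tz(1) abR by (simp add: K.r_distr K.m_lcomm)
    then show ?thesis unfolding J using TD(5) tz(1) u(1,2) by blast
  qed
  have "ideal ?J ?T"
  proof (rule idealI)
    show "ring ?T" by (rule D.ring_axioms)
    show "subgroup ?J (add_monoid ?T)"
    proof (rule D.add.subgroupI)
      show "?J \<subseteq> carrier ?T" using JT by simp
      show "?J \<noteq> {}" using TD(2) J by blast
      show "\<ominus>\<^bsub>?T\<^esub> z \<in> ?J" if z: "z \<in> ?J" for z
      proof -
        have "\<ominus>\<^bsub>?T\<^esub> z = (\<ominus>\<^bsub>?T\<^esub> \<one>\<^bsub>?T\<^esub>) \<otimes>\<^bsub>?T\<^esub> z"
          using subsetD[OF JT z] D.l_minus[of "\<one>\<^bsub>?T\<^esub>" z] D.l_one[of z] TD(3) by simp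
        moreover have "\<ominus>\<^bsub>?T\<^esub> \<one>\<^bsub>?T\<^esub> \<in> T" using D.a_inv_closed[OF D.one_closed] by simp
        ultimately show ?thesis using Jmult[OF _ z] by simp
      qed
      show "y \<oplus>\<^bsub>?T\<^esub> z \<in> ?J" if "y \<in> ?J" "z \<in> ?J" for y z
      proof -
        have "submodule ?J R (module_in K \<phi> T)" by (rule M.submodule_set_smult) (use abR in auto)
        from M.submoduleE(5)[OF this that] show ?thesis by simp
      qed
    qed
    show "x \<otimes>\<^bsub>?T\<^esub> z \<in> ?J" "z \<otimes>\<^bsub>?T\<^esub> x \<in> ?J" if "z \<in> ?J" "x \<in> carrier ?T" for x z
      using Jmult[of x z] that K.m_comm[of z x] JT TK by auto
  qed
  then obtain Q where Q: "primeideal Q ?T" "?J \<subseteq> Q" "Q \<inter> {\<one>\<^bsub>K\<^esub>} = {}"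
    using D.exists_prime_avoiding[of ?J "{\<one>\<^bsub>K\<^esub>}"] one TD(3) by auto
  interpret Q: primeideal Q ?T by (rule Q(1))
  have QT: "Q \<subseteq> T" using Q.a_subset by simp
  have maxQ: "\<phi> c \<in> Q" if c: "c \<in> max_ideal R" for c
  proof -
    have cR: "c \<in> carrier R" by (rule max_ideal_carrier[OF c])
    obtain n r s where rs: "r \<in> carrier R" "s \<in> carrier R"
        "c [^]\<^bsub>R\<^esub> (n::nat) = a \<otimes>\<^bsub>R\<^esub> r \<oplus>\<^bsub>R\<^esub> b \<otimes>\<^bsub>R\<^esub> s"
      by (rule system_of_parameters_pow_combination[OF sop c])
    have "\<phi> (c [^]\<^bsub>R\<^esub> n) = \<phi> a \<otimes>\<^bsub>K\<^esub> \<phi> r \<oplus>\<^bsub>K\<^esub> \<phi> b \<otimes>\<^bsub>K\<^esub> \<phi> s"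
      unfolding rs(3) using abR rs(1,2) by simp
    then have "\<phi> (c [^]\<^bsub>R\<^esub> n) \<in> ?J" unfolding J using TD(1) rs(1,2) by blast
    moreover have "\<phi> (c [^]\<^bsub>R\<^esub> n) = \<phi> c [^]\<^bsub>?T\<^esub> n"
      using cR K.nat_pow_consistent[of "\<phi> c" n T] by simp
    ultimately have "\<phi> c [^]\<^bsub>?T\<^esub> n \<in> Q" using Q(2) by auto
    then show ?thesis using primeideal_pow_mem[OF Q(1)] TD(1)[OF cR] by simp
  qed
  have "submodule Q R (module_in K \<phi> T)"
  proof (rule M.submoduleI)
    show "Q \<subseteq> carrier (module_in K \<phi> T)" using QT by simp
    show "\<zero>\<^bsub>module_in K \<phi> T\<^esub> \<in> Q" using Q.zero_closed by simp
    show "x \<oplus>\<^bsub>module_in K \<phi> T\<^esub> y \<in> Q" if "x \<in> Q" "y \<in> Q" for x y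
      using Q.a_closed[OF that] by simp
    show smult: "r \<odot>\<^bsub>module_in K \<phi> T\<^esub> x \<in> Q" if "r \<in> carrier R" "x \<in> Q" for r x
      using Q.I_l_closed[OF that(2), of "\<phi> r"] TD(1)[OF that(1)] by simp
    show "\<ominus>\<^bsub>module_in K \<phi> T\<^esub> x \<in> Q" if x: "x \<in> Q" for x
    proof -
      have xM: "x \<in> carrier (module_in K \<phi> T)" using x QT by auto
      show ?thesis
        using smult[OF R.a_inv_closed[OF R.one_closed] x]
        unfolding M.smult_l_minus[OF R.one_closed xM] M.smult_one[OF xM] .
    qed
  qed
  moreover have "{c \<odot>\<^bsub>module_in K \<phi> T\<^esub> v | c v. c \<in> max_ideal R \<and> v \<in> carrier (module_in K \<phi> T)} \<subseteq> Q"
    using Q.I_r_closed[OF maxQ] by auto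
  ultimately have "set_smult R (max_ideal R) (module_in K \<phi> T) \<subseteq> Q"
    unfolding set_smult_def by (rule generated_submodule_minimal)
  then show False using eq Q(3) TD(3) by auto
qed

text \<open>Each c in m has a power c^n = x r + y s, so c^n h is in T. With c = a and c = b this
  passes from an arbitrary system of parameters to the one pair that the depth condition
  supplies.\<close>

lemma S2_extension_system_of_parameters_step:
  assumes S2: "S2_extension R K \<phi> T" and xy: "system_of_parameters R [x, y]"
    and h: "h \<in> carrier K" "\<phi> x \<otimes>\<^bsub>K\<^esub> h \<in> T" "\<phi> y \<otimes>\<^bsub>K\<^esub> h \<in> T"
  shows "h \<in> T"
proof -
  have T: "overring T" using S2 by (simp add: S2_extension_def overring_def)
  obtain a b where ab: "a \<in> max_ideal R" "b \<in> max_ideal R" "regular_sequence R (module_in K \<phi> T) [a, b]"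
    using S2_extension_regular_pair[OF S2] by blast
  have abR: "a \<in> carrier R" "b \<in> carrier R" using ab max_ideal_carrier by auto
  have xyR: "x \<in> carrier R" "y \<in> carrier R"
    using xy max_ideal_carrier by (auto simp: system_of_parameters_pair_iff)
  have pow: "\<exists>n::nat. \<phi> (c [^]\<^bsub>R\<^esub> n) \<otimes>\<^bsub>K\<^esub> h \<in> T" if c: "c \<in> max_ideal R" for c
  proof -
    obtain n r s where rs: "r \<in> carrier R" "s \<in> carrier R"
        "c [^]\<^bsub>R\<^esub> (n::nat) = x \<otimes>\<^bsub>R\<^esub> r \<oplus>\<^bsub>R\<^esub> y \<otimes>\<^bsub>R\<^esub> s"
      by (rule system_of_parameters_pow_combination[OF xy c])
    have "\<phi> (c [^]\<^bsub>R\<^esub> n) \<otimes>\<^bsub>K\<^esub> h = \<phi> r \<otimes>\<^bsub>K\<^esub> (\<phi> x \<otimes>\<^bsub>K\<^esub> h) \<oplus>\<^bsub>K\<^esub> \<phi> s \<otimes>\<^bsub>K\<^esub> (\<phi> y \<otimes>\<^bsub>K\<^esub> h)"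
      unfolding rs(3) using xyR rs(1,2) h(1) by (simp add: K.l_distr K.r_distr K.m_ac)
    also have "\<dots> \<in> T" using overringD(2,6,7)[OF T] h(2,3) rs(1,2) by simp
    finally show ?thesis ..
  qed
  obtain n k where "\<phi> (a [^]\<^bsub>R\<^esub> (n::nat)) \<otimes>\<^bsub>K\<^esub> h \<in> T" "\<phi> (b [^]\<^bsub>R\<^esub> (k::nat)) \<otimes>\<^bsub>K\<^esub> h \<in> T"
    using pow[OF ab(1)] pow[OF ab(2)] by blast
  with ab(3)[unfolded regular_sequence_overring_pair[OF T]] show ?thesis
    by (intro mem_if_pow_mult_mem[OF T abR _ h(1)]) auto
qed

lemma S2_extension_big_cohen_macaulay:
  assumes S2: "S2_extension R K \<phi> T"
  shows "big_cohen_macaulay R (module_in K \<phi> T)"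
  unfolding big_cohen_macaulay_def
proof (intro conjI allI impI)
  have T: "overring T" using S2 by (simp add: S2_extension_def overring_def)
  show M: "module R (module_in K \<phi> T)" by (rule module_overring[OF T])
  show neq: "set_smult R (max_ideal R) (module_in K \<phi> T) \<noteq> carrier (module_in K \<phi> T)"
    using S2_extension_max_ideal_mult_neq[OF S2] by simp
  fix xs assume xs: "system_of_parameters R xs"
  then have "length xs = 2" using dim_eq by (simp add: system_of_parameters_def)
  then obtain x y where xy: "xs = [x, y]" by (auto simp: numeral_2_eq_2 length_Suc_conv)
  have sop: "system_of_parameters R [x, y]" using xs xy by simp
  then have xym: "x \<in> max_ideal R" "y \<in> max_ideal R" by (auto simp: system_of_parameters_pair_iff)
  then have xyR: "x \<in> carrier R" "y \<in> carrier R" using max_ideal_carrier by auto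
  note step = S2_extension_system_of_parameters_step[OF S2 sop]
  have smultT: "set_smult R {x, y} (module_in K \<phi> T) \<noteq> T"
  proof -
    have "set_smult R {x, y} (module_in K \<phi> T) \<subseteq> set_smult R (max_ideal R) (module_in K \<phi> T)"
      using xym by (intro set_smult_mono) auto
    moreover have "set_smult R (max_ideal R) (module_in K \<phi> T) \<subseteq> T"
      using module.set_smult_subset[OF M, of "max_ideal R"] max_ideal_carrier by auto
    ultimately show ?thesis using neq by auto
  qed
  \<comment> \<open>If x were 0, then h = 1 / y would satisfy x h = 0 and y h = 1, so it would lie
    in T and give y T = T. Here y is nonzero, since otherwise m would be 0 and the dimension could
    not be 2.\<close>
  have "x \<noteq> \<zero>\<^bsub>R\<^esub>"
  proof
    assume x0: "x = \<zero>\<^bsub>R\<^esub>"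
    have y0: "y \<noteq> \<zero>\<^bsub>R\<^esub>"
    proof
      assume y0: "y = \<zero>\<^bsub>R\<^esub>"
      have "max_ideal R \<subseteq> {\<zero>\<^bsub>R\<^esub>}"
        using sop x0 y0 R.zeroprimeideal by (simp add: system_of_parameters_pair_iff)
      then have "max_ideal R = {\<zero>\<^bsub>R\<^esub>}" using xym x0 by auto
      then show False
        using height_max_ideal[OF local_ring dim_eq] height_zero_ideal[OF R.domain_axioms] dim
        by simp
    qed
    then have phiy: "\<phi> y \<in> carrier K" "\<phi> y \<noteq> \<zero>\<^bsub>K\<^esub>" using xyR by (auto simp: phi_eq_zero_iff)
    let ?h = "inv\<^bsub>K\<^esub> \<phi> y"
    have "?h \<in> T"
      by (rule step) (use K_inv[OF phiy] x0 overringD(3,4)[OF T] in auto)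
    then have "\<phi> x \<otimes>\<^bsub>K\<^esub> \<zero>\<^bsub>K\<^esub> \<oplus>\<^bsub>K\<^esub> \<phi> y \<otimes>\<^bsub>K\<^esub> ?h \<in> set_smult R {x, y} (module_in K \<phi> T)"
      unfolding set_smult_overring_pair[OF T xyR] using overringD(3)[OF T] by blast
    then have "\<one>\<^bsub>K\<^esub> \<in> set_smult R {x, y} (module_in K \<phi> T)" using K_inv[OF phiy] xyR by simp
    then show False using smultT set_smult_overring_eq_iff[OF T xyR] by simp
  qed
  then show "regular_sequence R (module_in K \<phi> T) xs"
    unfolding xy regular_sequence_overring_pair[OF T] using xyR step smultT by blast
qed

section \<open>Sections over the punctured spectrum\<close>

text \<open>These are the sections of the structure sheaf over the spectrum without its closed
  point, also known as the ideal transform of m. Letting the exponent depend on c avoids powers of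
  the ideal m.\<close>

definition punctured_sections where
  "punctured_sections = {h \<in> carrier K. \<forall>c\<in>max_ideal R. \<exists>n::nat. \<phi> (c [^]\<^bsub>R\<^esub> n) \<otimes>\<^bsub>K\<^esub> h \<in> \<phi> ` carrier R}"

lemma punctured_sectionsE:
  assumes "h \<in> punctured_sections" "c \<in> max_ideal R"
  obtains n r where "r \<in> carrier R" "\<phi> (c [^]\<^bsub>R\<^esub> (n::nat)) \<otimes>\<^bsub>K\<^esub> h = \<phi> r"
  using assms unfolding punctured_sections_def by blast

lemma overring_punctured_sections: "overring punctured_sections"
  unfolding overring_def
proof
  show sub: "\<phi> ` carrier R \<subseteq> punctured_sections"
  proof
    fix z assume "z \<in> \<phi> ` carrier R"
    then have "z \<in> carrier K" "\<phi> (c [^]\<^bsub>R\<^esub> (0::nat)) \<otimes>\<^bsub>K\<^esub> z \<in> \<phi> ` carrier R" for c by auto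
    then show "z \<in> punctured_sections" unfolding punctured_sections_def by blast
  qed
  show "subring punctured_sections K"
  proof (rule K.subringI)
    show "punctured_sections \<subseteq> carrier K" by (auto simp: punctured_sections_def)
    show "\<one>\<^bsub>K\<^esub> \<in> punctured_sections" using sub hom.hom_one R.one_closed by (metis image_subset_iff)
    show "\<ominus>\<^bsub>K\<^esub> h \<in> punctured_sections" if h: "h \<in> punctured_sections" for h
    proof -
      have "\<exists>n::nat. \<phi> (c [^]\<^bsub>R\<^esub> n) \<otimes>\<^bsub>K\<^esub> (\<ominus>\<^bsub>K\<^esub> h) \<in> \<phi> ` carrier R" if c: "c \<in> max_ideal R" for c
      proof -
        obtain n r where "r \<in> carrier R" "\<phi> (c [^]\<^bsub>R\<^esub> (n::nat)) \<otimes>\<^bsub>K\<^esub> h = \<phi> r"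
          by (rule punctured_sectionsE[OF h c])
        then have "\<phi> (c [^]\<^bsub>R\<^esub> n) \<otimes>\<^bsub>K\<^esub> (\<ominus>\<^bsub>K\<^esub> h) = \<phi> (\<ominus>\<^bsub>R\<^esub> r)"
          using h max_ideal_carrier[OF c] by (simp add: punctured_sections_def K.r_minus)
        then show ?thesis using R.a_inv_closed[OF \<open>r \<in> carrier R\<close>] by blast
      qed
      then show ?thesis using h by (simp add: punctured_sections_def)
    qed
    fix h h' assume h: "h \<in> punctured_sections" and h': "h' \<in> punctured_sections"
    have hK: "h \<in> carrier K" "h' \<in> carrier K" using h h' by (auto simp: punctured_sections_def)
    \<comment> \<open>The exponents for h and h' add up to one that serves the product and the sum
      at once.\<close>
    have *: "\<exists>n::nat. \<phi> (c [^]\<^bsub>R\<^esub> n) \<otimes>\<^bsub>K\<^esub> (h \<otimes>\<^bsub>K\<^esub> h') \<in> \<phi> ` carrier R \<and>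
        \<phi> (c [^]\<^bsub>R\<^esub> n) \<otimes>\<^bsub>K\<^esub> (h \<oplus>\<^bsub>K\<^esub> h') \<in> \<phi> ` carrier R" if c: "c \<in> max_ideal R" for c
    proof -
      have cR: "c \<in> carrier R" by (rule max_ideal_carrier[OF c])
      obtain n r where r: "r \<in> carrier R" "\<phi> (c [^]\<^bsub>R\<^esub> (n::nat)) \<otimes>\<^bsub>K\<^esub> h = \<phi> r"
        by (rule punctured_sectionsE[OF h c])
      obtain n' r' where r': "r' \<in> carrier R" "\<phi> (c [^]\<^bsub>R\<^esub> (n'::nat)) \<otimes>\<^bsub>K\<^esub> h' = \<phi> r'"
        by (rule punctured_sectionsE[OF h' c])
      let ?p = "c [^]\<^bsub>R\<^esub> n" and ?q = "c [^]\<^bsub>R\<^esub> n'"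
      have pq: "c [^]\<^bsub>R\<^esub> (n + n') = ?p \<otimes>\<^bsub>R\<^esub> ?q" "?p \<in> carrier R" "?q \<in> carrier R"
        using cR by (simp_all add: R.nat_pow_mult)
      have pqK: "\<phi> ?p \<in> carrier K" "\<phi> ?q \<in> carrier K" using pq by (simp_all del: hom.hom_pow)
      have "\<phi> (?p \<otimes>\<^bsub>R\<^esub> ?q) \<otimes>\<^bsub>K\<^esub> (h \<otimes>\<^bsub>K\<^esub> h') = (\<phi> ?p \<otimes>\<^bsub>K\<^esub> h) \<otimes>\<^bsub>K\<^esub> (\<phi> ?q \<otimes>\<^bsub>K\<^esub> h')"
        using pq pqK hK by (simp add: K.m_ac del: hom.hom_pow)
      also have "\<dots> = \<phi> (r \<otimes>\<^bsub>R\<^esub> r')" unfolding r(2) r'(2) using r(1) r'(1) by simp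
      finally have 1: "\<phi> (c [^]\<^bsub>R\<^esub> (n + n')) \<otimes>\<^bsub>K\<^esub> (h \<otimes>\<^bsub>K\<^esub> h') = \<phi> (r \<otimes>\<^bsub>R\<^esub> r')" unfolding pq(1) .
      have "\<phi> (?p \<otimes>\<^bsub>R\<^esub> ?q) \<otimes>\<^bsub>K\<^esub> (h \<oplus>\<^bsub>K\<^esub> h') =
          \<phi> ?q \<otimes>\<^bsub>K\<^esub> (\<phi> ?p \<otimes>\<^bsub>K\<^esub> h) \<oplus>\<^bsub>K\<^esub> \<phi> ?p \<otimes>\<^bsub>K\<^esub> (\<phi> ?q \<otimes>\<^bsub>K\<^esub> h')"
        using pq pqK hK by (simp add: K.l_distr K.r_distr K.m_ac del: hom.hom_pow)
      also have "\<dots> = \<phi> (?q \<otimes>\<^bsub>R\<^esub> r \<oplus>\<^bsub>R\<^esub> ?p \<otimes>\<^bsub>R\<^esub> r')"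
        unfolding r(2) r'(2) using r(1) r'(1) pq by (simp del: hom.hom_pow)
      finally have 2: "\<phi> (c [^]\<^bsub>R\<^esub> (n + n')) \<otimes>\<^bsub>K\<^esub> (h \<oplus>\<^bsub>K\<^esub> h') = \<phi> (?q \<otimes>\<^bsub>R\<^esub> r \<oplus>\<^bsub>R\<^esub> ?p \<otimes>\<^bsub>R\<^esub> r')"
        unfolding pq(1) .
      have "r \<otimes>\<^bsub>R\<^esub> r' \<in> carrier R" "?q \<otimes>\<^bsub>R\<^esub> r \<oplus>\<^bsub>R\<^esub> ?p \<otimes>\<^bsub>R\<^esub> r' \<in> carrier R"
        using r(1) r'(1) pq by auto
      with 1 2 show ?thesis by blast
    qed
    show "h \<otimes>\<^bsub>K\<^esub> h' \<in> punctured_sections"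
      unfolding punctured_sections_def using * hK by blast
    show "h \<oplus>\<^bsub>K\<^esub> h' \<in> punctured_sections"
      unfolding punctured_sections_def using * hK by blast
  qed
qed

text \<open>Powers of a and b carry h into R and thus into T; the regular pair a, b then pulls h
  itself into T.\<close>

lemma punctured_sections_subset:
  assumes S2: "S2_extension R K \<phi> T"
  shows "punctured_sections \<subseteq> T"
proof
  have T: "overring T" using S2 by (simp add: S2_extension_def overring_def)
  obtain a b where ab: "a \<in> max_ideal R" "b \<in> max_ideal R" "regular_sequence R (module_in K \<phi> T) [a, b]"
    using S2_extension_regular_pair[OF S2] by blast
  have abR: "a \<in> carrier R" "b \<in> carrier R" using ab max_ideal_carrier by auto
  fix h assume h: "h \<in> punctured_sections"
  obtain n r where r: "r \<in> carrier R" "\<phi> (a [^]\<^bsub>R\<^esub> (n::nat)) \<otimes>\<^bsub>K\<^esub> h = \<phi> r"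
    by (rule punctured_sectionsE[OF h ab(1)])
  obtain n' r' where r': "r' \<in> carrier R" "\<phi> (b [^]\<^bsub>R\<^esub> (n'::nat)) \<otimes>\<^bsub>K\<^esub> h = \<phi> r'"
    by (rule punctured_sectionsE[OF h ab(2)])
  show "h \<in> T"
  proof (rule mem_if_pow_mult_mem[OF T abR])
    show "g \<in> T" if "g \<in> carrier K" "\<phi> a \<otimes>\<^bsub>K\<^esub> g \<in> T" "\<phi> b \<otimes>\<^bsub>K\<^esub> g \<in> T" for g
      using ab(3)[unfolded regular_sequence_overring_pair[OF T]] that by blast
    show "h \<in> carrier K" using h by (simp add: punctured_sections_def)
    show "\<phi> (a [^]\<^bsub>R\<^esub> n) \<otimes>\<^bsub>K\<^esub> h \<in> T" unfolding r(2) by (rule overringD(2)[OF T r(1)])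
    show "\<phi> (b [^]\<^bsub>R\<^esub> n') \<otimes>\<^bsub>K\<^esub> h \<in> T" unfolding r'(2) by (rule overringD(2)[OF T r'(1)])
  qed
qed

text \<open>A power c^k = x s + y t expresses c^k h by x h and y h, and c^n and c^n' carry these two
  into R. The exponent k + (n + n') does both.\<close>

lemma punctured_sections_step:
  assumes xy: "system_of_parameters R [x, y]" and h: "h \<in> carrier K"
    and hx: "\<phi> x \<otimes>\<^bsub>K\<^esub> h \<in> punctured_sections" and hy: "\<phi> y \<otimes>\<^bsub>K\<^esub> h \<in> punctured_sections"
  shows "h \<in> punctured_sections"
proof -
  have xyR: "x \<in> carrier R" "y \<in> carrier R"
    using xy max_ideal_carrier by (auto simp: system_of_parameters_pair_iff)
  have "\<exists>k::nat. \<phi> (c [^]\<^bsub>R\<^esub> k) \<otimes>\<^bsub>K\<^esub> h \<in> \<phi> ` carrier R" if c: "c \<in> max_ideal R" for c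
  proof -
    have cR: "c \<in> carrier R" by (rule max_ideal_carrier[OF c])
    obtain k s t where st: "s \<in> carrier R" "t \<in> carrier R"
        "c [^]\<^bsub>R\<^esub> (k::nat) = x \<otimes>\<^bsub>R\<^esub> s \<oplus>\<^bsub>R\<^esub> y \<otimes>\<^bsub>R\<^esub> t"
      by (rule system_of_parameters_pow_combination[OF xy c])
    obtain n r where r: "r \<in> carrier R" "\<phi> (c [^]\<^bsub>R\<^esub> (n::nat)) \<otimes>\<^bsub>K\<^esub> (\<phi> x \<otimes>\<^bsub>K\<^esub> h) = \<phi> r"
      by (rule punctured_sectionsE[OF hx c])
    obtain n' r' where r': "r' \<in> carrier R" "\<phi> (c [^]\<^bsub>R\<^esub> (n'::nat)) \<otimes>\<^bsub>K\<^esub> (\<phi> y \<otimes>\<^bsub>K\<^esub> h) = \<phi> r'"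
      by (rule punctured_sectionsE[OF hy c])
    let ?p = "c [^]\<^bsub>R\<^esub> n" and ?q = "c [^]\<^bsub>R\<^esub> n'"
    have pq: "c [^]\<^bsub>R\<^esub> (k + (n + n')) = (x \<otimes>\<^bsub>R\<^esub> s \<oplus>\<^bsub>R\<^esub> y \<otimes>\<^bsub>R\<^esub> t) \<otimes>\<^bsub>R\<^esub> (?p \<otimes>\<^bsub>R\<^esub> ?q)"
        "?p \<in> carrier R" "?q \<in> carrier R"
      using cR by (simp_all add: R.nat_pow_mult st(3)[symmetric])
    have pqK: "\<phi> ?p \<in> carrier K" "\<phi> ?q \<in> carrier K" using pq by (simp_all del: hom.hom_pow)
    have "\<phi> (c [^]\<^bsub>R\<^esub> (k + (n + n'))) \<otimes>\<^bsub>K\<^esub> h =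
        \<phi> s \<otimes>\<^bsub>K\<^esub> (\<phi> ?q \<otimes>\<^bsub>K\<^esub> (\<phi> ?p \<otimes>\<^bsub>K\<^esub> (\<phi> x \<otimes>\<^bsub>K\<^esub> h))) \<oplus>\<^bsub>K\<^esub>
        \<phi> t \<otimes>\<^bsub>K\<^esub> (\<phi> ?p \<otimes>\<^bsub>K\<^esub> (\<phi> ?q \<otimes>\<^bsub>K\<^esub> (\<phi> y \<otimes>\<^bsub>K\<^esub> h)))"
      unfolding pq(1) using pq(2,3) pqK h xyR st(1,2)
      by (simp add: K.l_distr K.r_distr K.m_ac del: hom.hom_pow)
    also have "\<dots> = \<phi> (s \<otimes>\<^bsub>R\<^esub> (?q \<otimes>\<^bsub>R\<^esub> r) \<oplus>\<^bsub>R\<^esub> t \<otimes>\<^bsub>R\<^esub> (?p \<otimes>\<^bsub>R\<^esub> r'))"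
      unfolding r(2) r'(2) using r(1) r'(1) pq(2,3) st(1,2) by (simp del: hom.hom_pow)
    moreover have "s \<otimes>\<^bsub>R\<^esub> (?q \<otimes>\<^bsub>R\<^esub> r) \<oplus>\<^bsub>R\<^esub> t \<otimes>\<^bsub>R\<^esub> (?p \<otimes>\<^bsub>R\<^esub> r') \<in> carrier R"
      using r(1) r'(1) pq(2,3) st(1,2) by simp
    ultimately show ?thesis by (metis imageI)
  qed
  then show ?thesis using h by (simp add: punctured_sections_def)
qed

text \<open>At m the pair a, b is borrowed from T: it is a system of parameters, which gives
  regularity, and it generates a proper submodule since the punctured sections lie in T. At any
  other nonzero prime the height is at most 1, so one regular element is enough.\<close>

lemma S2_extension_punctured_sections:
  assumes S2: "S2_extension R K \<phi> T"
  shows "S2_extension R K \<phi> punctured_sections"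
  unfolding S2_extension_def serre_condition_def
proof (intro conjI allI impI)
  let ?H = punctured_sections
  have T: "overring T" using S2 by (simp add: S2_extension_def overring_def)
  note H = overring_punctured_sections
  show "subring ?H K" "\<phi> ` carrier R \<subseteq> ?H" using H by (simp_all add: overring_def)
  fix P assume P: "primeideal P R"
  interpret P: primeideal P R by (rule P)
  let ?A = "localize_in R K \<phi> P (\<phi> ` carrier R)" and ?HP = "localize_in R K \<phi> P ?H"
  let ?depth = "depth (K\<lparr>carrier := ?A\<rparr>) (localize_in R K \<phi> P (\<phi> ` P)) (module_in K (\<lambda>x. x) ?HP)"
  consider "P = max_ideal R" | "P = {\<zero>\<^bsub>R\<^esub>}" | "P \<noteq> max_ideal R" "P \<noteq> {\<zero>\<^bsub>R\<^esub>}" by blast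
  then show "min (enat 2) (height R P) \<le> ?depth"
  proof cases
    case 1
    obtain a b where ab: "a \<in> max_ideal R" "b \<in> max_ideal R" "regular_sequence R (module_in K \<phi> T) [a, b]"
      using S2_extension_regular_pair[OF S2] by blast
    have sop: "system_of_parameters R [a, b]" by (rule S2_extension_system_of_parameters[OF S2 ab])
    have abR: "a \<in> carrier R" "b \<in> carrier R" using ab max_ideal_carrier by auto
    have "set_smult R {a, b} (module_in K \<phi> ?H) \<subseteq> set_smult R {a, b} (module_in K \<phi> T)"
      unfolding set_smult_overring_pair[OF H abR] set_smult_overring_pair[OF T abR]
      using punctured_sections_subset[OF S2] by blast
    moreover have "\<one>\<^bsub>K\<^esub> \<notin> set_smult R {a, b} (module_in K \<phi> T)"
      using ab(3)[unfolded regular_sequence_overring_pair[OF T]] set_smult_overring_eq_iff[OF T abR] by simp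
    ultimately have "set_smult R {a, b} (module_in K \<phi> ?H) \<noteq> ?H"
      using set_smult_overring_eq_iff[OF H abR] by blast
    then have "regular_sequence R (module_in K \<phi> ?H) [a, b]"
      unfolding regular_sequence_overring_pair[OF H]
      using abR ab(3)[unfolded regular_sequence_overring_pair[OF T]] punctured_sections_step[OF sop] by blast
    then have "regular_sequence (K\<lparr>carrier := \<phi> ` carrier R\<rparr>) (module_in K (\<lambda>x. x) ?H) [\<phi> a, \<phi> b]"
      unfolding regular_sequence_base_change[OF H abR] .
    then have "regular_sequence (K\<lparr>carrier := ?A\<rparr>) (module_in K (\<lambda>x. x) ?HP) [\<phi> a, \<phi> b]"
      using localize_max_ideal_overring[OF H] localize_max_ideal_overring[OF overring_phi_image] 1 by simp
    moreover have "set [\<phi> a, \<phi> b] \<subseteq> localize_in R K \<phi> P (\<phi> ` P)"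
      using localize_max_ideal_image ab(1,2) 1 by simp
    ultimately have "enat (length [\<phi> a, \<phi> b]) \<le> ?depth" by (intro depth_ge)
    then have "enat 2 \<le> ?depth" by (simp add: numeral_2_eq_2)
    then show ?thesis by (rule min.coboundedI1)
  next
    case 2
    then show ?thesis using height_zero_ideal[OF R.domain_axioms] by simp
  next
    case 3
    obtain p where p: "p \<in> P" "p \<noteq> \<zero>\<^bsub>R\<^esub>" using 3(2) P.zero_closed by blast
    have pR: "p \<in> carrier R" using p(1) by simp
    \<comment> \<open>Powers of c are denominators allowed at P, so localizing the punctured
      sections at P leads to nothing beyond R_P, where p is not a unit.\<close>
    obtain c where c: "c \<in> max_ideal R" "c \<notin> P"
      using 3(1) prime_subset_max_ideal[OF local_ring P] by blast
    have cR: "c \<in> carrier R" by (rule max_ideal_carrier[OF c(1)])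
    interpret A: frac_field "K\<lparr>carrier := ?A\<rparr>" K "\<lambda>x. x" by (rule frac_field_localize[OF P])
    have AH: "A.overring ?HP" by (rule overring_localize[OF P H])
    have "\<phi> ` P \<subseteq> carrier K" by auto
    then have pP: "\<phi> p \<in> localize_in R K \<phi> P (\<phi> ` P)"
      unfolding mem_localize_iff[OF P \<open>\<phi> ` P \<subseteq> carrier K\<close>]
      using pR p(1) compl_prime(1)[OF P] by (auto intro!: bexI[of _ "\<one>\<^bsub>R\<^esub>"])
    \<comment> \<open>From 1 = p t, clearing denominators gives c^n s = p r in R, with the left side
      outside P and the right side in P.\<close>
    have no: "\<one>\<^bsub>K\<^esub> \<noteq> \<phi> p \<otimes>\<^bsub>K\<^esub> t" if t: "t \<in> ?HP" for t
    proof
      assume eq: "\<one>\<^bsub>K\<^esub> = \<phi> p \<otimes>\<^bsub>K\<^esub> t"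
      obtain s where s: "t \<in> carrier K" "s \<in> carrier R - P" "\<phi> s \<otimes>\<^bsub>K\<^esub> t \<in> ?H"
        using t mem_localize_iff[OF P overringD(1)[OF H]] by blast
      have sR: "s \<in> carrier R" using s(2) by simp
      obtain n r where r: "r \<in> carrier R" "\<phi> (c [^]\<^bsub>R\<^esub> (n::nat)) \<otimes>\<^bsub>K\<^esub> (\<phi> s \<otimes>\<^bsub>K\<^esub> t) = \<phi> r"
        by (rule punctured_sectionsE[OF s(3) c(1)])
      have qR: "c [^]\<^bsub>R\<^esub> n \<in> carrier R" "\<phi> (c [^]\<^bsub>R\<^esub> n) \<in> carrier K" using cR by (simp_all del: hom.hom_pow)
      have "\<phi> (c [^]\<^bsub>R\<^esub> n \<otimes>\<^bsub>R\<^esub> s) = \<phi> (c [^]\<^bsub>R\<^esub> n) \<otimes>\<^bsub>K\<^esub> \<phi> s \<otimes>\<^bsub>K\<^esub> (\<phi> p \<otimes>\<^bsub>K\<^esub> t)"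
        unfolding eq[symmetric] using qR sR by (simp del: hom.hom_pow)
      also have "\<dots> = \<phi> p \<otimes>\<^bsub>K\<^esub> (\<phi> (c [^]\<^bsub>R\<^esub> n) \<otimes>\<^bsub>K\<^esub> (\<phi> s \<otimes>\<^bsub>K\<^esub> t))"
        using qR(2) sR s(1) pR by (simp add: K.m_ac del: hom.hom_pow)
      also have "\<dots> = \<phi> (p \<otimes>\<^bsub>R\<^esub> r)" unfolding r(2) using pR r(1) by simp
      finally have "c [^]\<^bsub>R\<^esub> n \<otimes>\<^bsub>R\<^esub> s = p \<otimes>\<^bsub>R\<^esub> r"
        using phi_eq_iff[OF R.m_closed[OF qR(1) sR] R.m_closed[OF pR r(1)]] by blast
      then have "c [^]\<^bsub>R\<^esub> n \<otimes>\<^bsub>R\<^esub> s \<in> P" using P.I_r_closed[OF p(1) r(1)] by simp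
      moreover have "c [^]\<^bsub>R\<^esub> n \<otimes>\<^bsub>R\<^esub> s \<in> carrier R - P"
        using compl_prime(2,3)[OF P] c(2) cR s(2) by blast
      ultimately show False by blast
    qed
    have "\<phi> p \<in> ?A" using overringD(2)[OF localize_overring(1)[OF P overring_phi_image] pR] .
    moreover have "\<phi> p \<noteq> \<zero>\<^bsub>K\<^esub>" using p(2) pR by (simp add: phi_eq_zero_iff)
    ultimately have "regular_sequence (K\<lparr>carrier := ?A\<rparr>) (module_in K (\<lambda>x. x) ?HP) [\<phi> p]"
      unfolding A.regular_sequence_overring_singleton[OF AH] using no by auto
    moreover have "set [\<phi> p] \<subseteq> localize_in R K \<phi> P (\<phi> ` P)" using pP by simp
    ultimately have "enat (length [\<phi> p]) \<le> ?depth" by (intro depth_ge)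
    then have "1 \<le> ?depth" by (simp add: one_enat_def)
    moreover have "height R P \<le> 1" by (rule height_le_1[OF local_ring dim P 3(1)])
    ultimately show ?thesis by (meson min.coboundedI2 order_trans)
  qed
qed

section \<open>Linear maps from the punctured sections to a big Cohen--Macaulay module\<close>

text \<open>If \<open>a\<^sup>n h\<close> and \<open>b\<^sup>k h\<close> are in \<open>R\<close>, then \<open>b\<^sup>k (a\<^sup>n h) w = a\<^sup>n (b\<^sup>k h) w\<close>, so regularity of
  \<open>a\<^sup>n, b\<^sup>k\<close> on \<open>B\<close> makes \<open>(a\<^sup>n h) w\<close> uniquely divisible by \<open>a\<^sup>n\<close>; the quotient is \<open>f h\<close>.\<close>

lemma punctured_sections_linear_map:
  assumes B: "big_cohen_macaulay R B" and ab: "system_of_parameters R [a, b]"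
    and w: "w \<in> carrier B"
  obtains f where "f \<in> punctured_sections \<rightarrow> carrier B" "f \<one>\<^bsub>K\<^esub> = w"
    and "\<And>h h'. h \<in> punctured_sections \<Longrightarrow> h' \<in> punctured_sections \<Longrightarrow>
      f (h \<oplus>\<^bsub>K\<^esub> h') = f h \<oplus>\<^bsub>B\<^esub> f h'"
    and "\<And>r h. r \<in> carrier R \<Longrightarrow> h \<in> punctured_sections \<Longrightarrow> f (\<phi> r \<otimes>\<^bsub>K\<^esub> h) = r \<odot>\<^bsub>B\<^esub> f h"
proof -
  interpret B: module R B using B by (simp add: big_cohen_macaulay_def)
  have aR: "a \<in> carrier R" and bR: "b \<in> carrier R" and abm: "a \<in> max_ideal R" "b \<in> max_ideal R"
    using ab max_ideal_carrier by (auto simp: system_of_parameters_pair_iff)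
  have a_reg: "v = \<zero>\<^bsub>B\<^esub>" if "v \<in> carrier B" "a \<odot>\<^bsub>B\<^esub> v = \<zero>\<^bsub>B\<^esub>" for v
    using B ab that by (auto simp: big_cohen_macaulay_def B.regular_sequence_pair)
  let ?a = "\<lambda>n::nat. a [^]\<^bsub>R\<^esub> n"
  have aC: "?a n \<in> carrier R" for n using aR by simp
  have a_add: "?a (n + k) = ?a k \<otimes>\<^bsub>R\<^esub> ?a n" for n k
    using aR by (simp add: R.nat_pow_mult add.commute)
  have apow_zero: "v = \<zero>\<^bsub>B\<^esub>" if "v \<in> carrier B" "?a n \<odot>\<^bsub>B\<^esub> v = \<zero>\<^bsub>B\<^esub>" for v n
    using that
  proof (induction n)
    case (Suc n)
    have "a \<odot>\<^bsub>B\<^esub> (?a n \<odot>\<^bsub>B\<^esub> v) = ?a (Suc n) \<odot>\<^bsub>B\<^esub> v"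
      using B.smult_assoc1[OF aR aC Suc.prems(1), of n] R.m_comm[OF aR aC] by simp
    then have "?a n \<odot>\<^bsub>B\<^esub> v = \<zero>\<^bsub>B\<^esub>" using a_reg Suc.prems aC B.smult_closed by metis
    then show ?case using Suc by blast
  qed simp
  have apow_cancel: "v = v'" if v: "v \<in> carrier B" "v' \<in> carrier B" "?a n \<odot>\<^bsub>B\<^esub> v = ?a n \<odot>\<^bsub>B\<^esub> v'" for v v' n
  proof -
    have "?a n \<odot>\<^bsub>B\<^esub> (v \<oplus>\<^bsub>B\<^esub> (\<ominus>\<^bsub>B\<^esub> v')) = \<zero>\<^bsub>B\<^esub>"
      using v aC by (simp add: B.smult_r_distr B.smult_r_minus B.r_neg)
    then have "v \<oplus>\<^bsub>B\<^esub> (\<ominus>\<^bsub>B\<^esub> v') = \<zero>\<^bsub>B\<^esub>" using apow_zero[of "v \<oplus>\<^bsub>B\<^esub> (\<ominus>\<^bsub>B\<^esub> v')" n] v by simp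
    then show ?thesis using v B.M.minus_equality[of v "\<ominus>\<^bsub>B\<^esub> v'"] B.M.minus_minus[of v'] by simp
  qed
  \<comment> \<open>The relation \<open>D n h v\<close> says that v behaves like h w once both are
    multiplied by a^n. The exponent stays visible so that values found with different exponents can
    be compared.\<close>
  define D where "D n h v \<longleftrightarrow> v \<in> carrier B \<and>
      (\<exists>r\<in>carrier R. \<phi> (?a n) \<otimes>\<^bsub>K\<^esub> h = \<phi> r \<and> ?a n \<odot>\<^bsub>B\<^esub> v = r \<odot>\<^bsub>B\<^esub> w)" for n h v
  have D_add: "D (n + k) h v" if D: "D n h v" and h: "h \<in> carrier K" for n k h v
  proof -
    obtain r where r: "v \<in> carrier B" "r \<in> carrier R" "\<phi> (?a n) \<otimes>\<^bsub>K\<^esub> h = \<phi> r" "?a n \<odot>\<^bsub>B\<^esub> v = r \<odot>\<^bsub>B\<^esub> w"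
      using D unfolding D_def by blast
    have K: "\<phi> (?a n) \<in> carrier K" "\<phi> (?a k) \<in> carrier K" using aC by (simp_all del: hom.hom_pow)
    have "\<phi> (?a (n + k)) \<otimes>\<^bsub>K\<^esub> h = \<phi> (?a k) \<otimes>\<^bsub>K\<^esub> (\<phi> (?a n) \<otimes>\<^bsub>K\<^esub> h)"
      unfolding a_add using aC K h by (simp add: K.m_assoc del: hom.hom_pow)
    also have "\<dots> = \<phi> (?a k \<otimes>\<^bsub>R\<^esub> r)" unfolding r(3) using aC r(2) by (simp del: hom.hom_pow)
    finally have "\<phi> (?a (n + k)) \<otimes>\<^bsub>K\<^esub> h = \<phi> (?a k \<otimes>\<^bsub>R\<^esub> r)" .
    moreover have "?a (n + k) \<odot>\<^bsub>B\<^esub> v = (?a k \<otimes>\<^bsub>R\<^esub> r) \<odot>\<^bsub>B\<^esub> w"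
      unfolding a_add using aC r w by (simp add: B.smult_assoc1)
    ultimately show ?thesis using r(1,2) aC unfolding D_def by blast
  qed
  \<comment> \<open>At the common exponent n + k both values satisfy an equation with the same r,
    because \<open>\<phi>\<close> is injective, and a^(n + k) cancels on B.\<close>
  have D_unique: "v = v'" if D: "D n h v" "D k h v'" and h: "h \<in> carrier K" for n k h v v'
  proof -
    have "D (n + k) h v" "D (n + k) h v'" using D_add[OF D(1) h, of k] D_add[OF D(2) h, of n] by (simp_all add: add.commute)
    then show ?thesis unfolding D_def using apow_cancel phi_eq_iff by metis
  qed
  have D_exists: "\<exists>v n. D n h v" if h: "h \<in> punctured_sections" for h
  proof -
    have hK: "h \<in> carrier K" using h by (simp add: punctured_sections_def)
    obtain n r where r: "r \<in> carrier R" "\<phi> (?a n) \<otimes>\<^bsub>K\<^esub> h = \<phi> r"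
      by (rule punctured_sectionsE[OF h abm(1)])
    obtain k s where s: "s \<in> carrier R" "\<phi> (b [^]\<^bsub>R\<^esub> (k::nat)) \<otimes>\<^bsub>K\<^esub> h = \<phi> s"
      by (rule punctured_sectionsE[OF h abm(2)])
    \<comment> \<open>Both exponents are raised by one: n or k may be 0, and then the power itself
      would be 1 instead of an element of m.\<close>
    let ?x = "?a (Suc n)" and ?y = "b [^]\<^bsub>R\<^esub> Suc k"
    have xy: "?x \<in> carrier R" "?y \<in> carrier R" "\<phi> ?x \<in> carrier K" "\<phi> ?y \<in> carrier K"
      "\<phi> (?a n) \<in> carrier K" "\<phi> (b [^]\<^bsub>R\<^esub> k) \<in> carrier K"
      using aR bR by (simp_all del: hom.hom_pow nat_pow_Suc)
    have "\<phi> ?x \<otimes>\<^bsub>K\<^esub> h = \<phi> a \<otimes>\<^bsub>K\<^esub> (\<phi> (?a n) \<otimes>\<^bsub>K\<^esub> h)"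
      using aR hK xy by (simp add: K.m_ac del: hom.hom_pow)
    then have xh: "\<phi> ?x \<otimes>\<^bsub>K\<^esub> h = \<phi> (a \<otimes>\<^bsub>R\<^esub> r)"
      unfolding r(2) using aR r(1) by simp
    have "\<phi> ?y \<otimes>\<^bsub>K\<^esub> h = \<phi> b \<otimes>\<^bsub>K\<^esub> (\<phi> (b [^]\<^bsub>R\<^esub> k) \<otimes>\<^bsub>K\<^esub> h)"
      using bR hK xy by (simp add: K.m_ac del: hom.hom_pow)
    then have yh: "\<phi> ?y \<otimes>\<^bsub>K\<^esub> h = \<phi> (b \<otimes>\<^bsub>R\<^esub> s)"
      unfolding s(2) using bR s(1) by simp
    have "\<phi> (?y \<otimes>\<^bsub>R\<^esub> (a \<otimes>\<^bsub>R\<^esub> r)) = \<phi> ?y \<otimes>\<^bsub>K\<^esub> (\<phi> ?x \<otimes>\<^bsub>K\<^esub> h)"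
      unfolding xh using xy aR r(1) by (simp del: hom.hom_pow nat_pow_Suc)
    also have "\<dots> = \<phi> ?x \<otimes>\<^bsub>K\<^esub> (\<phi> ?y \<otimes>\<^bsub>K\<^esub> h)" by (rule K.m_lcomm[OF xy(4,3) hK])
    also have "\<dots> = \<phi> (?x \<otimes>\<^bsub>R\<^esub> (b \<otimes>\<^bsub>R\<^esub> s))"
      unfolding yh using xy bR s(1) by (simp del: hom.hom_pow nat_pow_Suc)
    finally have eq: "?y \<otimes>\<^bsub>R\<^esub> (a \<otimes>\<^bsub>R\<^esub> r) = ?x \<otimes>\<^bsub>R\<^esub> (b \<otimes>\<^bsub>R\<^esub> s)"
      using phi_eq_iff[of "?y \<otimes>\<^bsub>R\<^esub> (a \<otimes>\<^bsub>R\<^esub> r)" "?x \<otimes>\<^bsub>R\<^esub> (b \<otimes>\<^bsub>R\<^esub> s)"]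
        R.m_closed[OF xy(2) R.m_closed[OF aR r(1)]] R.m_closed[OF xy(1) R.m_closed[OF bR s(1)]] by blast
    have arw: "(a \<otimes>\<^bsub>R\<^esub> r) \<odot>\<^bsub>B\<^esub> w \<in> carrier B" and bsw: "(b \<otimes>\<^bsub>R\<^esub> s) \<odot>\<^bsub>B\<^esub> w \<in> carrier B"
      using aR bR r(1) s(1) w by auto
    have "?y \<odot>\<^bsub>B\<^esub> ((a \<otimes>\<^bsub>R\<^esub> r) \<odot>\<^bsub>B\<^esub> w) = ?x \<odot>\<^bsub>B\<^esub> ((b \<otimes>\<^bsub>R\<^esub> s) \<odot>\<^bsub>B\<^esub> w)"
      using eq xy(1,2) aR bR r(1) s(1) w
        B.smult_assoc1[of ?y "a \<otimes>\<^bsub>R\<^esub> r" w] B.smult_assoc1[of ?x "b \<otimes>\<^bsub>R\<^esub> s" w]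
      by (simp del: nat_pow_Suc)
    moreover have "regular_sequence R B [?x, ?y]"
      using B system_of_parameters_pow[OF ab] by (simp add: big_cohen_macaulay_def del: nat_pow_Suc)
    ultimately obtain v where v: "v \<in> carrier B" "(a \<otimes>\<^bsub>R\<^esub> r) \<odot>\<^bsub>B\<^esub> w = ?x \<odot>\<^bsub>B\<^esub> v"
      using arw bsw unfolding B.regular_sequence_pair by blast
    then have "D (Suc n) h v"
      unfolding D_def using xh aR r(1) by (metis R.m_closed)
    then show ?thesis by blast
  qed
  define f where "f h = (THE v. \<exists>n. D n h v)" for h
  have f_eq: "f h = v" if D: "D n h v" and h: "h \<in> carrier K" for n h v
    unfolding f_def using D D_unique[OF _ D h] by (intro the_equality) blast+
  have Df: "\<exists>n. D n h (f h)" "h \<in> carrier K" if h: "h \<in> punctured_sections" for h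
  proof -
    show hK: "h \<in> carrier K" using h by (simp add: punctured_sections_def)
    obtain n v where "D n h v" using D_exists[OF h] by blast
    then show "\<exists>n. D n h (f h)" using f_eq[OF _ hK] by metis
  qed
  show thesis
  proof (rule that)
    show "f \<in> punctured_sections \<rightarrow> carrier B" using Df(1) unfolding D_def by blast
    have "D 0 \<one>\<^bsub>K\<^esub> w" unfolding D_def using w by (auto intro!: bexI[of _ "\<one>\<^bsub>R\<^esub>"])
    then show "f \<one>\<^bsub>K\<^esub> = w" by (rule f_eq) simp
  next
    fix h h' assume h: "h \<in> punctured_sections" and h': "h' \<in> punctured_sections"
    note hK = Df(2)[OF h] Df(2)[OF h']
    obtain n k where nk: "D n h (f h)" "D k h' (f h')" using Df(1)[OF h] Df(1)[OF h'] by blast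
    let ?N = "n + k"
    have "D ?N h (f h)" "D ?N h' (f h')"
      using D_add[OF nk(1) hK(1), of k] D_add[OF nk(2) hK(2), of n] by (simp_all add: add.commute)
    then obtain r r' where r: "f h \<in> carrier B" "r \<in> carrier R" "\<phi> (?a ?N) \<otimes>\<^bsub>K\<^esub> h = \<phi> r" "?a ?N \<odot>\<^bsub>B\<^esub> f h = r \<odot>\<^bsub>B\<^esub> w"
      and r': "f h' \<in> carrier B" "r' \<in> carrier R" "\<phi> (?a ?N) \<otimes>\<^bsub>K\<^esub> h' = \<phi> r'" "?a ?N \<odot>\<^bsub>B\<^esub> f h' = r' \<odot>\<^bsub>B\<^esub> w"
      unfolding D_def by blast
    have "\<phi> (?a ?N) \<in> carrier K" using aC by (simp del: hom.hom_pow)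
    then have "\<phi> (?a ?N) \<otimes>\<^bsub>K\<^esub> (h \<oplus>\<^bsub>K\<^esub> h') = \<phi> (r \<oplus>\<^bsub>R\<^esub> r')"
      using hK r(2,3) r'(2,3) by (simp add: K.r_distr del: hom.hom_pow)
    moreover have "?a ?N \<odot>\<^bsub>B\<^esub> (f h \<oplus>\<^bsub>B\<^esub> f h') = (r \<oplus>\<^bsub>R\<^esub> r') \<odot>\<^bsub>B\<^esub> w"
      using aC r r' w by (simp add: B.smult_r_distr B.smult_l_distr)
    ultimately have "D ?N (h \<oplus>\<^bsub>K\<^esub> h') (f h \<oplus>\<^bsub>B\<^esub> f h')"
      unfolding D_def using r(1,2) r'(1,2) by blast
    then show "f (h \<oplus>\<^bsub>K\<^esub> h') = f h \<oplus>\<^bsub>B\<^esub> f h'" by (rule f_eq) (use hK in simp)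
  next
    fix q h assume q: "q \<in> carrier R" and h: "h \<in> punctured_sections"
    note hK = Df(2)[OF h]
    obtain n where "D n h (f h)" using Df(1)[OF h] by blast
    then obtain r where r: "f h \<in> carrier B" "r \<in> carrier R" "\<phi> (?a n) \<otimes>\<^bsub>K\<^esub> h = \<phi> r" "?a n \<odot>\<^bsub>B\<^esub> f h = r \<odot>\<^bsub>B\<^esub> w"
      unfolding D_def by blast
    have "\<phi> (?a n) \<in> carrier K" using aC by (simp del: hom.hom_pow)
    then have "\<phi> (?a n) \<otimes>\<^bsub>K\<^esub> (\<phi> q \<otimes>\<^bsub>K\<^esub> h) = \<phi> q \<otimes>\<^bsub>K\<^esub> (\<phi> (?a n) \<otimes>\<^bsub>K\<^esub> h)"
      using hK q by (intro K.m_lcomm) auto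
    also have "\<dots> = \<phi> (q \<otimes>\<^bsub>R\<^esub> r)" unfolding r(3) using q r(2) by simp
    finally have 1: "\<phi> (?a n) \<otimes>\<^bsub>K\<^esub> (\<phi> q \<otimes>\<^bsub>K\<^esub> h) = \<phi> (q \<otimes>\<^bsub>R\<^esub> r)" .
    have "?a n \<odot>\<^bsub>B\<^esub> (q \<odot>\<^bsub>B\<^esub> f h) = q \<odot>\<^bsub>B\<^esub> (?a n \<odot>\<^bsub>B\<^esub> f h)"
      using B.smult_assoc1[OF aC q r(1), of n] B.smult_assoc1[OF q aC r(1), of n] R.m_comm[OF aC q, of n] by simp
    also have "\<dots> = (q \<otimes>\<^bsub>R\<^esub> r) \<odot>\<^bsub>B\<^esub> w" unfolding r(4) using q r(2) w by (simp add: B.smult_assoc1)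
    finally have "D n (\<phi> q \<otimes>\<^bsub>K\<^esub> h) (q \<odot>\<^bsub>B\<^esub> f h)"
      unfolding D_def using 1 q r(1,2) by blast
    then show "f (\<phi> q \<otimes>\<^bsub>K\<^esub> h) = q \<odot>\<^bsub>B\<^esub> f h" by (rule f_eq) (use hK q in simp)
  qed
qed

end

theorem proposition4p16:
  fixes R :: "'a ring" and K :: "'k ring" and \<phi> :: "'a \<Rightarrow> 'k" and S :: "'k set"
  assumes "local_ring R" and "domain R" and "krull_dim R = 2"
    and "fraction_field R K \<phi>"
    and "S2_ification R K \<phi> S"
  shows "big_cohen_macaulay R (module_in K \<phi> S) \<and>
    (\<forall>(B' :: ('a, 'b) module) (M :: ('a, 'c) module) N.
       big_cohen_macaulay R B' \<and>
       finitely_generated_module R M \<and> submodule N R M \<and>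
       finitely_generated_module R (M\<lparr>carrier := N\<rparr>) \<longrightarrow>
       module_closure R (module_in K \<phi> S) M N \<subseteq> module_closure R B' M N)"
proof (intro conjI allI impI)
  interpret local_domain_dim2 R K \<phi>
    using assms by unfold_locales
  have S2: "S2_extension R K \<phi> S" using assms(5) by (simp add: S2_ification_def)
  have "S \<subseteq> punctured_sections"
    using assms(5) S2_extension_punctured_sections[OF S2] by (simp add: S2_ification_def)
  then have S: "S = punctured_sections" using punctured_sections_subset[OF S2] by blast
  show "big_cohen_macaulay R (module_in K \<phi> S)" by (rule S2_extension_big_cohen_macaulay[OF S2])
  \<comment> \<open>For \<open>B'\<close> this pair matters only as a system of parameters, and as
    such it is regular on \<open>B'\<close> too.\<close>
  obtain a b where ab: "a \<in> max_ideal R" "b \<in> max_ideal R" "regular_sequence R (module_in K \<phi> S) [a, b]"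
    using S2_extension_regular_pair[OF S2] by blast
  have sop: "system_of_parameters R [a, b]" by (rule S2_extension_system_of_parameters[OF S2 ab])
  fix B' :: "('a, 'b) module" and M :: "('a, 'c) module" and N
  assume *: "big_cohen_macaulay R B' \<and> finitely_generated_module R M \<and> submodule N R M \<and>
       finitely_generated_module R (M\<lparr>carrier := N\<rparr>)"
  show "module_closure R (module_in K \<phi> S) M N \<subseteq> module_closure R B' M N"
  proof (rule module_closure_mono)
    show "module R (module_in K \<phi> S)"
      unfolding S by (rule module_overring[OF overring_punctured_sections])
    show "module R B'" "module R M" "submodule N R M"
      using * by (auto simp: big_cohen_macaulay_def finitely_generated_module_def)
    fix w assume w: "w \<in> carrier B'"
    \<comment> \<open>Each w receives its own map, with 1 as preimage; a single map onto
      \<open>B'\<close> is not asked for.\<close>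
    obtain f where "f \<in> S \<rightarrow> carrier B'" "f \<one>\<^bsub>K\<^esub> = w"
      "\<And>h h'. h \<in> S \<Longrightarrow> h' \<in> S \<Longrightarrow> f (h \<oplus>\<^bsub>K\<^esub> h') = f h \<oplus>\<^bsub>B'\<^esub> f h'"
      "\<And>r h. r \<in> carrier R \<Longrightarrow> h \<in> S \<Longrightarrow> f (\<phi> r \<otimes>\<^bsub>K\<^esub> h) = r \<odot>\<^bsub>B'\<^esub> f h"
      using punctured_sections_linear_map[OF _ sop w] * unfolding S by metis
    moreover have "\<one>\<^bsub>K\<^esub> \<in> S" unfolding S by (rule overringD(4)[OF overring_punctured_sections])
    ultimately show "\<exists>f s. s \<in> carrier (module_in K \<phi> S) \<and> f s = w \<and>
        f \<in> carrier (module_in K \<phi> S) \<rightarrow> carrier B' \<and>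
        (\<forall>x\<in>carrier (module_in K \<phi> S). \<forall>y\<in>carrier (module_in K \<phi> S).
          f (x \<oplus>\<^bsub>module_in K \<phi> S\<^esub> y) = f x \<oplus>\<^bsub>B'\<^esub> f y) \<and>
        (\<forall>r\<in>carrier R. \<forall>x\<in>carrier (module_in K \<phi> S).
          f (r \<odot>\<^bsub>module_in K \<phi> S\<^esub> x) = r \<odot>\<^bsub>B'\<^esub> f x)"
      by (intro exI[of _ f] exI[of _ "\<one>\<^bsub>K\<^esub>"]) simp
  qed
qed

end
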